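(* Let $\mathcal{A}$ be a bicomplete, locally small abelian category and let $\tau:T\hookrightarrow1_{\mathcal{A}}$ be any preradical of $\mathcal{A}$. Then $$\tau=\bigvee_{M\in\mathcal{A}}\alpha_{\tau_M},$$ where, for each $M\in\mathcal{A}$, $\tau_M:T(M)\to M$ is the corresponding component of $\tau$.
   Context: Bicomplete means complete and cocomplete; locally small means that the class of subobjects of each object is a set; Hom-classes are sets. A preradical of an abelian category $\mathcal{A}$ is a subobject of the identity functor $1_{\mathcal{A}}$ in the (possibly extended) abelian category $\mathrm{Fun}(\mathcal{A},\mathcal{A})$, i.e. the equivalence class of a monomorphic natural transformation $\tau:T\hookrightarrow 1_{\mathcal{A}}$, two such being equivalent if each factors through the other. $Pr(\mathcal{A})$ is the collection of preradicals, ordered by $\tau\leq\sigma$ iff $\tau$ factors through $\sigma$; under the stated hypotheses on $\mathcal{A}$ every collection of preradicals (not necessarily a set) has a join $\bigvee$ and a meet $\bigwedge$. Alpha preradicals: for objects $N,M$ of $\mathcal{A}$, $\mathbb{A}_M^N:\mathcal{A}\to\mathcal{A}$ is the functor with $\mathbb{A}_M^N(L)=N^{(\mathrm{Hom}_{\mathcal{A}}(M,L))}$ (coproduct of copies of $N$ indexed by $\mathrm{Hom}_{\mathcal{A}}(M,L)$, with canonical inclusions $i_f$), and, for $\lambda:L\to L'$, $\mathbb{A}_M^N(\lambda)\circ i_f=i'_{\lambda\circ f}$. For a morphism $h:N\to M$, $\mathfrak{a}_h:\mathbb{A}_M^N\to1_{\mathcal{A}}$ is the natural transformation determined by $[\mathfrak{a}_h]_L\circ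 i_f=f\circ h$ for all $L$ and all $f\in\mathrm{Hom}_{\mathcal{A}}(M,L)$. The alpha preradical associated to $h$ is $\alpha_h:=\mathrm{Im}(\mathfrak{a}_h)$. *)

theory Defs
  imports "HOL-Algebra.Group" "HOL-Library.FuncSet"
begin

unbundle cardinal_syntax

section \<open>Smallness\<close>

text \<open>
  ``Sets'' are the members of a Grothendieck universe, ``classes'' are arbitrary HOL sets.
  Up to bijection a universe is determined by its cardinal, given here by a type \<open>'u\<close>: a
  collection is a set iff it has fewer elements than \<open>'u\<close>.  The cardinal of \<open>'u\<close> is infinite,
  regular and a strong limit; the value aleph-null (hereditarily finite sets) is not excluded.
\<close>

definition small :: "'u itself \<Rightarrow> 'x set \<Rightarrow> bool" where
  "small U X \<longleftrightarrow> |X| <o |UNIV :: 'u set|"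

definition grothendieck_universe :: "'u itself \<Rightarrow> bool" where
  "grothendieck_universe U \<longleftrightarrow>
     infinite (UNIV :: 'u set) \<and>
     regularCard |UNIV :: 'u set| \<and>
     (\<forall>X :: 'u set. small U X \<longrightarrow> small U (Pow X))"


section \<open>Categories\<close>

record ('o, 'a) cat =
  Obj :: "'o set"
  Arr :: "'a set"
  Dom :: "'a \<Rightarrow> 'o"
  Cod :: "'a \<Rightarrow> 'o"
  Idn :: "'o \<Rightarrow> 'a"
  Comp :: "'a \<Rightarrow> 'a \<Rightarrow> 'a" (infixl "\<cdot>\<index>" 70)

definition Hom :: "('o, 'a) cat \<Rightarrow> 'o \<Rightarrow> 'o \<Rightarrow> 'a set" where
  "Hom C X Y = {f \<in> Arr C. Dom C f = X \<and> Cod C f = Y}"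

locale category =
  fixes C :: "('o, 'a) cat" (structure)
  assumes dom_in: "f \<in> Arr C \<Longrightarrow> Dom C f \<in> Obj C"
    and cod_in: "f \<in> Arr C \<Longrightarrow> Cod C f \<in> Obj C"
    and idn_in: "X \<in> Obj C \<Longrightarrow> Idn C X \<in> Hom C X X"
    and comp_in: "\<lbrakk>f \<in> Hom C X Y; g \<in> Hom C Y Z\<rbrakk> \<Longrightarrow> g \<cdot> f \<in> Hom C X Z"
    and idn_right: "f \<in> Arr C \<Longrightarrow> f \<cdot> Idn C (Dom C f) = f"
    and idn_left: "f \<in> Arr C \<Longrightarrow> Idn C (Cod C f) \<cdot> f = f"
    and comp_assoc:
      "\<lbrakk>f \<in> Hom C W X; g \<in> Hom C X Y; h \<in> Hom C Y Z\<rbrakk> \<Longrightarrow> (h \<cdot> g) \<cdot> f = h \<cdot> (g \<cdot> f)"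

definition opposite :: "('o, 'a) cat \<Rightarrow> ('o, 'a) cat" where
  "opposite C = \<lparr>Obj = Obj C, Arr = Arr C, Dom = Cod C, Cod = Dom C, Idn = Idn C,
           Comp = (\<lambda>g f. f \<cdot>\<^bsub>C\<^esub> g)\<rparr>"

definition small_homs :: "'u itself \<Rightarrow> ('o, 'a) cat \<Rightarrow> bool" where
  "small_homs U C \<longleftrightarrow> (\<forall>X\<in>Obj C. \<forall>Y\<in>Obj C. small U (Hom C X Y))"


section \<open>Functors and natural transformations\<close>

text \<open>
  All maps are taken to be undefined outside the objects (arrows) of the source category, so
  that equality in HOL is equality of functors and of natural transformations.
\<close>

record ('o, 'a, 'p, 'b) func =
  ObjMap :: "'o \<Rightarrow> 'p"
  ArrMap :: "'a \<Rightarrow> 'b"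

definition is_functor :: "('o, 'a) cat \<Rightarrow> ('p, 'b) cat \<Rightarrow> ('o, 'a, 'p, 'b) func \<Rightarrow> bool" where
  "is_functor J C F \<longleftrightarrow>
     ObjMap F \<in> Obj J \<rightarrow>\<^sub>E Obj C \<and>
     ArrMap F \<in> Arr J \<rightarrow>\<^sub>E Arr C \<and>
     (\<forall>f\<in>Arr J. ArrMap F f \<in> Hom C (ObjMap F (Dom J f)) (ObjMap F (Cod J f))) \<and>
     (\<forall>X\<in>Obj J. ArrMap F (Idn J X) = Idn C (ObjMap F X)) \<and>
     (\<forall>f\<in>Arr J. \<forall>g\<in>Arr J. Dom J g = Cod J f \<longrightarrow>
        ArrMap F (g \<cdot>\<^bsub>J\<^esub> f) = ArrMap F g \<cdot>\<^bsub>C\<^esub> ArrMap F f)"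

definition id_functor :: "('o, 'a) cat \<Rightarrow> ('o, 'a, 'o, 'a) func" where
  "id_functor C = \<lparr>ObjMap = (\<lambda>X\<in>Obj C. X), ArrMap = (\<lambda>f\<in>Arr C. f)\<rparr>"

record ('o, 'a, 'p, 'b) ntrans =
  Src :: "('o, 'a, 'p, 'b) func"
  Tgt :: "('o, 'a, 'p, 'b) func"
  Cmp :: "'o \<Rightarrow> 'b"

definition is_ntrans :: "('o, 'a) cat \<Rightarrow> ('p, 'b) cat \<Rightarrow> ('o, 'a, 'p, 'b) ntrans \<Rightarrow> bool" where
  "is_ntrans J C t \<longleftrightarrow>
     is_functor J C (Src t) \<and> is_functor J C (Tgt t) \<and>
     Cmp t \<in> extensional (Obj J) \<and>
     (\<forall>X\<in>Obj J. Cmp t X \<in> Hom C (ObjMap (Src t) X) (ObjMap (Tgt t) X)) \<and>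
     (\<forall>f\<in>Arr J. Cmp t (Cod J f) \<cdot>\<^bsub>C\<^esub> ArrMap (Src t) f = ArrMap (Tgt t) f \<cdot>\<^bsub>C\<^esub> Cmp t (Dom J f))"

definition Fun :: "('o, 'a) cat \<Rightarrow> ('p, 'b) cat \<Rightarrow>
    (('o, 'a, 'p, 'b) func, ('o, 'a, 'p, 'b) ntrans) cat" where
  "Fun J C = \<lparr>
     Obj = {F. is_functor J C F},
     Arr = {t. is_ntrans J C t},
     Dom = Src,
     Cod = Tgt,
     Idn = (\<lambda>F. \<lparr>Src = F, Tgt = F, Cmp = (\<lambda>X\<in>Obj J. Idn C (ObjMap F X))\<rparr>),
     Comp = (\<lambda>s t. \<lparr>Src = Src t, Tgt = Tgt s, Cmp = (\<lambda>X\<in>Obj J. Cmp s X \<cdot>\<^bsub>C\<^esub> Cmp t X)\<rparr>)\<rparr>"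


section \<open>Limits and colimits\<close>

definition is_cone :: "('i, 'j) cat \<Rightarrow> ('o, 'a) cat \<Rightarrow> ('i, 'j, 'o, 'a) func \<Rightarrow>
    'o \<Rightarrow> ('i \<Rightarrow> 'a) \<Rightarrow> bool" where
  "is_cone J C D P p \<longleftrightarrow>
     P \<in> Obj C \<and>
     (\<forall>j\<in>Obj J. p j \<in> Hom C P (ObjMap D j)) \<and>
     (\<forall>f\<in>Arr J. ArrMap D f \<cdot>\<^bsub>C\<^esub> p (Dom J f) = p (Cod J f))"

definition is_limit :: "('i, 'j) cat \<Rightarrow> ('o, 'a) cat \<Rightarrow> ('i, 'j, 'o, 'a) func \<Rightarrow>
    'o \<Rightarrow> ('i \<Rightarrow> 'a) \<Rightarrow> bool" where
  "is_limit J C D P p \<longleftrightarrow>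
     is_cone J C D P p \<and>
     (\<forall>Q q. is_cone J C D Q q \<longrightarrow> (\<exists>!u. u \<in> Hom C Q P \<and> (\<forall>j\<in>Obj J. p j \<cdot>\<^bsub>C\<^esub> u = q j)))"

text \<open>Every small category is isomorphic to one with objects and arrows in \<open>'u\<close>.\<close>

definition complete_category :: "'u itself \<Rightarrow> ('o, 'a) cat \<Rightarrow> bool" where
  "complete_category U C \<longleftrightarrow>
     (\<forall>(J :: ('u, 'u) cat) D.
        category J \<and> small U (Obj J) \<and> small U (Arr J) \<and> is_functor J C D \<longrightarrow>
        (\<exists>P p. is_limit J C D P p))"

definition bicomplete :: "'u itself \<Rightarrow> ('o, 'a) cat \<Rightarrow> bool" where
  "bicomplete U C \<longleftrightarrow> complete_category U C \<and> complete_category U (opposite C)"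

definition is_product :: "('o, 'a) cat \<Rightarrow> 'i set \<Rightarrow> ('i \<Rightarrow> 'o) \<Rightarrow> 'o \<Rightarrow> ('i \<Rightarrow> 'a) \<Rightarrow> bool" where
  "is_product C I X P p \<longleftrightarrow>
     P \<in> Obj C \<and>
     (\<forall>i\<in>I. p i \<in> Hom C P (X i)) \<and>
     (\<forall>Q\<in>Obj C. \<forall>q. (\<forall>i\<in>I. q i \<in> Hom C Q (X i)) \<longrightarrow>
        (\<exists>!u. u \<in> Hom C Q P \<and> (\<forall>i\<in>I. p i \<cdot>\<^bsub>C\<^esub> u = q i)))"

abbreviation is_coproduct :: "('o, 'a) cat \<Rightarrow> 'i set \<Rightarrow> ('i \<Rightarrow> 'o) \<Rightarrow> 'o \<Rightarrow> ('i \<Rightarrow> 'a) \<Rightarrow> bool" where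
  "is_coproduct C \<equiv> is_product (opposite C)"


section \<open>Monomorphisms and subobjects\<close>

definition is_mono :: "('o, 'a) cat \<Rightarrow> 'a \<Rightarrow> bool" where
  "is_mono C m \<longleftrightarrow>
     m \<in> Arr C \<and>
     (\<forall>f\<in>Arr C. \<forall>g\<in>Arr C. Cod C f = Dom C m \<and> Cod C g = Dom C m \<and> Dom C f = Dom C g \<and>
        m \<cdot>\<^bsub>C\<^esub> f = m \<cdot>\<^bsub>C\<^esub> g \<longrightarrow> f = g)"

abbreviation is_epi :: "('o, 'a) cat \<Rightarrow> 'a \<Rightarrow> bool" where
  "is_epi C \<equiv> is_mono (opposite C)"

definition Monos :: "('o, 'a) cat \<Rightarrow> 'o \<Rightarrow> 'a set" where
  "Monos C X = {m. is_mono C m \<and> Cod C m = X}"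

definition factors_through :: "('o, 'a) cat \<Rightarrow> 'a \<Rightarrow> 'a \<Rightarrow> bool" where
  "factors_through C f g \<longleftrightarrow> (\<exists>u\<in>Hom C (Dom C f) (Dom C g). f = g \<cdot>\<^bsub>C\<^esub> u)"

definition subobject :: "('o, 'a) cat \<Rightarrow> 'a \<Rightarrow> 'a set" where
  "subobject C m =
     {m' \<in> Monos C (Cod C m). factors_through C m m' \<and> factors_through C m' m}"

definition Sub :: "('o, 'a) cat \<Rightarrow> 'o \<Rightarrow> 'a set gorder" where
  "Sub C X = \<lparr>carrier = subobject C ` Monos C X, eq = (=),
              le = (\<lambda>S S'. \<exists>m\<in>S. \<exists>m'\<in>S'. factors_through C m m')\<rparr>"

definition locally_small :: "'u itself \<Rightarrow> ('o, 'a) cat \<Rightarrow> bool" where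
  "locally_small U C \<longleftrightarrow> (\<forall>X\<in>Obj C. small U (carrier (Sub C X)))"


section \<open>Abelian categories\<close>

definition zero_object :: "('o, 'a) cat \<Rightarrow> 'o \<Rightarrow> bool" where
  "zero_object C Z \<longleftrightarrow>
     Z \<in> Obj C \<and> (\<forall>X\<in>Obj C. (\<exists>!f. f \<in> Hom C X Z) \<and> (\<exists>!f. f \<in> Hom C Z X))"

definition zero_arrow :: "('o, 'a) cat \<Rightarrow> 'a \<Rightarrow> bool" where
  "zero_arrow C f \<longleftrightarrow>
     (\<exists>Z g h. zero_object C Z \<and> g \<in> Hom C (Dom C f) Z \<and> h \<in> Hom C Z (Cod C f) \<and>
        f = h \<cdot>\<^bsub>C\<^esub> g)"

definition is_kernel :: "('o, 'a) cat \<Rightarrow> 'a \<Rightarrow> 'a \<Rightarrow> bool" where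
  "is_kernel C f k \<longleftrightarrow>
     f \<in> Arr C \<and> k \<in> Arr C \<and> Cod C k = Dom C f \<and> zero_arrow C (f \<cdot>\<^bsub>C\<^esub> k) \<and>
     (\<forall>g\<in>Arr C. Cod C g = Dom C f \<and> zero_arrow C (f \<cdot>\<^bsub>C\<^esub> g) \<longrightarrow>
        (\<exists>!u. u \<in> Hom C (Dom C g) (Dom C k) \<and> k \<cdot>\<^bsub>C\<^esub> u = g))"

abbreviation is_cokernel :: "('o, 'a) cat \<Rightarrow> 'a \<Rightarrow> 'a \<Rightarrow> bool" where
  "is_cokernel C \<equiv> is_kernel (opposite C)"

text \<open>The hom-groups are written multiplicatively, as groups of HOL-Algebra.\<close>

definition preadditive :: "('o, 'a) cat \<Rightarrow> ('o \<Rightarrow> 'o \<Rightarrow> 'a monoid) \<Rightarrow> bool" where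
  "preadditive C G \<longleftrightarrow>
     category C \<and>
     (\<forall>X\<in>Obj C. \<forall>Y\<in>Obj C. comm_group (G X Y) \<and> carrier (G X Y) = Hom C X Y) \<and>
     (\<forall>X\<in>Obj C. \<forall>Y\<in>Obj C. \<forall>Z\<in>Obj C.
        \<forall>f\<in>Hom C X Y. \<forall>f'\<in>Hom C X Y. \<forall>g\<in>Hom C Y Z. \<forall>g'\<in>Hom C Y Z.
          g \<cdot>\<^bsub>C\<^esub> (f \<otimes>\<^bsub>G X Y\<^esub> f') = (g \<cdot>\<^bsub>C\<^esub> f) \<otimes>\<^bsub>G X Z\<^esub> (g \<cdot>\<^bsub>C\<^esub> f') \<and>
          (g \<otimes>\<^bsub>G Y Z\<^esub> g') \<cdot>\<^bsub>C\<^esub> f = (g \<cdot>\<^bsub>C\<^esub> f) \<otimes>\<^bsub>G X Z\<^esub> (g' \<cdot>\<^bsub>C\<^esub> f))"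

definition abelian_category :: "('o, 'a) cat \<Rightarrow> bool" where
  "abelian_category C \<longleftrightarrow>
     (\<exists>G. preadditive C G) \<and>
     (\<exists>Z. zero_object C Z) \<and>
     (\<forall>X\<in>Obj C. \<forall>Y\<in>Obj C. \<exists>P p. is_product C (UNIV :: bool set) (\<lambda>b. if b then X else Y) P p) \<and>
     (\<forall>f\<in>Arr C. (\<exists>k. is_kernel C f k) \<and> (\<exists>c. is_cokernel C f c)) \<and>
     (\<forall>m. is_mono C m \<longrightarrow> (\<exists>f. is_kernel C f m)) \<and>
     (\<forall>e. is_epi C e \<longrightarrow> (\<exists>f. is_cokernel C f e))"

text \<open>The image, as a subobject of the codomain, is the kernel of the cokernel; since kernels
  and cokernels are unique up to isomorphism, all of them form a single subobject.\<close>

definition image_subobject :: "('o, 'a) cat \<Rightarrow> 'a \<Rightarrow> 'a set" where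
  "image_subobject C f = {m. \<exists>c. is_cokernel C f c \<and> is_kernel C c m}"


section \<open>Preradicals\<close>

definition Pr :: "('o, 'a) cat \<Rightarrow> ('o, 'a, 'o, 'a) ntrans set gorder" where
  "Pr C = Sub (Fun C C) (id_functor C)"

text \<open>The choice of the coproducts changes the functors below only up to natural isomorphism, and
  so does not affect the subobject \<open>alpha_preradical C h\<close>.\<close>

definition copower :: "('o, 'a) cat \<Rightarrow> 'o \<Rightarrow> 'a set \<Rightarrow> 'o \<times> ('a \<Rightarrow> 'a)" where
  "copower C N I = (SOME Q. is_coproduct C I (\<lambda>_. N) (fst Q) (snd Q))"

definition alpha_obj :: "('o, 'a) cat \<Rightarrow> 'o \<Rightarrow> 'o \<Rightarrow> 'o \<Rightarrow> 'o" where
  "alpha_obj C N M L = fst (copower C N (Hom C M L))"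

definition alpha_incl :: "('o, 'a) cat \<Rightarrow> 'o \<Rightarrow> 'o \<Rightarrow> 'o \<Rightarrow> 'a \<Rightarrow> 'a" where
  "alpha_incl C N M L = snd (copower C N (Hom C M L))"

definition alpha_functor :: "('o, 'a) cat \<Rightarrow> 'o \<Rightarrow> 'o \<Rightarrow> ('o, 'a, 'o, 'a) func" where
  "alpha_functor C N M = \<lparr>
     ObjMap = (\<lambda>L\<in>Obj C. alpha_obj C N M L),
     ArrMap = (\<lambda>l\<in>Arr C. THE u.
       u \<in> Hom C (alpha_obj C N M (Dom C l)) (alpha_obj C N M (Cod C l)) \<and>
       (\<forall>f\<in>Hom C M (Dom C l).
          u \<cdot>\<^bsub>C\<^esub> alpha_incl C N M (Dom C l) f = alpha_incl C N M (Cod C l) (l \<cdot>\<^bsub>C\<^esub> f)))\<rparr>"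

definition alpha_ntrans :: "('o, 'a) cat \<Rightarrow> 'a \<Rightarrow> ('o, 'a, 'o, 'a) ntrans" where
  "alpha_ntrans C h = \<lparr>
     Src = alpha_functor C (Dom C h) (Cod C h),
     Tgt = id_functor C,
     Cmp = (\<lambda>L\<in>Obj C. THE u.
       u \<in> Hom C (alpha_obj C (Dom C h) (Cod C h) L) L \<and>
       (\<forall>f\<in>Hom C (Cod C h) L. u \<cdot>\<^bsub>C\<^esub> alpha_incl C (Dom C h) (Cod C h) L f = f \<cdot>\<^bsub>C\<^esub> h))\<rparr>"

definition alpha_preradical :: "('o, 'a) cat \<Rightarrow> 'a \<Rightarrow> ('o, 'a, 'o, 'a) ntrans set" where
  "alpha_preradical C h = image_subobject (Fun C C) (alpha_ntrans C h)"

end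

theory Submission
  imports Defs
begin

text \<open>Naturality gives \<open>\<tau>\<^sub>L \<circ> T(f) = f \<circ> \<tau>\<^sub>M\<close> for \<open>f : M \<rightarrow> L\<close>, so the natural
  transformation with image \<open>\<alpha>\<^bsub>\<tau>\<^sub>M\<^esub>\<close> factors through \<open>\<tau>\<close>, hence so does its image.
  Conversely, if \<open>\<sigma>\<close> contains all these images, then restricting to the copy of \<open>T(M)\<close> indexed by
  the identity of \<open>M\<close> shows that \<open>\<tau>\<^sub>M\<close> factors through \<open>\<sigma>\<^sub>M\<close> for every \<open>M\<close>.  Kernels and
  cokernels of natural transformations are computed pointwise, so monic transformations have monic
  components; factorizations through the components are therefore automatically natural.\<close>

section \<open>Opposite categories\<close>

text \<open>\<open>alpha_preradical\<close> is a kernel of a cokernel formed in the functor category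
  itself, so zero arrows, kernels and cokernels there must be understood before anything can be
  compared with it. The image of an arrow is least among the kernels through which the arrow
  factors; bounding it by \<tau> therefore requires \<tau>, given only as a monomorphism, to be a
  kernel. This is assembled from components: each is monic, hence the kernel of its own cokernel.
  Monic components are where addition of arrows enters: a monic transformation has zero kernel, and
  a component with zero kernel is monic because the difference of two parallel arrows can be formed.
  Cocompleteness and smallness of the hom-sets enter through the existence of the copowers that
  define \<open>alpha_functor\<close>.\<close>

lemma Hom_iff: "f \<in> Hom C X Y \<longleftrightarrow> f \<in> Arr C \<and> Dom C f = X \<and> Cod C f = Y"
  by (simp add: Hom_def)

lemma opposite_simps [simp]:
  "Obj (opposite C) = Obj C" "Arr (opposite C) = Arr C"
  "Dom (opposite C) = Cod C" "Cod (opposite C) = Dom C"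
  "Idn (opposite C) = Idn C" "Comp (opposite C) g f = Comp C f g"
  "opposite (opposite C) = C"
  by (simp_all add: opposite_def)

lemma Hom_opposite [simp]: "Hom (opposite C) X Y = Hom C Y X"
  by (auto simp: Hom_def)

lemma category_opposite: "category C \<Longrightarrow> category (opposite C)"
  unfolding category_def by (simp; metis)

lemma zero_object_opposite [simp]: "zero_object (opposite C) Z = zero_object C Z"
  by (auto simp: zero_object_def)

lemma zero_arrow_opposite [simp]: "zero_arrow (opposite C) f = zero_arrow C f"
  unfolding zero_arrow_def by auto

lemma carrier_Sub: "carrier (Sub C X) = subobject C ` Monos C X"
  by (simp add: Sub_def)

section \<open>Zero arrows and kernels\<close>

lemma zero_objectD:
  assumes "zero_object C Z"
  shows "Z \<in> Obj C" "X \<in> Obj C \<Longrightarrow> \<exists>!f. f \<in> Hom C X Z" "X \<in> Obj C \<Longrightarrow> \<exists>!f. f \<in> Hom C Z X"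
  using assms by (simp_all add: zero_object_def)

context category
begin

lemma Hom_Obj: "f \<in> Hom C X Y \<Longrightarrow> X \<in> Obj C \<and> Y \<in> Obj C"
  using dom_in cod_in by (auto simp: Hom_iff)

lemma idn_right_Hom: "f \<in> Hom C X Y \<Longrightarrow> f \<cdot> Idn C X = f"
  and idn_left_Hom: "f \<in> Hom C X Y \<Longrightarrow> Idn C Y \<cdot> f = f"
  using idn_right idn_left by (auto simp: Hom_iff)

lemma mono_cancel:
  "\<lbrakk>is_mono C m; m \<in> Hom C Y Z; f \<in> Hom C X Y; g \<in> Hom C X Y; m \<cdot> f = m \<cdot> g\<rbrakk> \<Longrightarrow> f = g"
  unfolding is_mono_def by (auto simp: Hom_iff)

lemma monoI:
  assumes "m \<in> Hom C Y Z"
    and "\<And>X f g. \<lbrakk>f \<in> Hom C X Y; g \<in> Hom C X Y; m \<cdot> f = m \<cdot> g\<rbrakk> \<Longrightarrow> f = g"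
  shows "is_mono C m"
  unfolding is_mono_def
proof (intro conjI ballI impI)
  show "m \<in> Arr C" using assms(1) by (simp add: Hom_iff)
  fix f g assume fg: "f \<in> Arr C" "g \<in> Arr C"
    and eq: "Cod C f = Dom C m \<and> Cod C g = Dom C m \<and> Dom C f = Dom C g \<and> m \<cdot> f = m \<cdot> g"
  have "f \<in> Hom C (Dom C f) Y" "g \<in> Hom C (Dom C f) Y"
    using fg eq assms(1) by (auto simp: Hom_iff)
  then show "f = g" by (rule assms(2)) (simp add: eq)
qed

lemma zero_arrowI:
  assumes "zero_object C Z" "g \<in> Hom C X Z" "h \<in> Hom C Z Y"
  shows "zero_arrow C (h \<cdot> g)"
proof -
  have "Dom C (h \<cdot> g) = X" "Cod C (h \<cdot> g) = Y" using comp_in[OF assms(2,3)] by (simp_all add: Hom_iff)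
  then show ?thesis using assms unfolding zero_arrow_def by blast
qed

text \<open>\<open>zero_arrow\<close> only provides some zero object; the canonical arrows between
  two zero objects move the factorization to a prescribed one. With a common middle object, two zero
  arrows can be compared.\<close>

lemma zero_arrow_through:
  assumes Z: "zero_object C Z" and f: "zero_arrow C f"
    and fXY: "f \<in> Hom C X Y"
  obtains g h where "g \<in> Hom C X Z" "h \<in> Hom C Z Y" "f = h \<cdot> g"
proof -
  obtain Z' g h where Z': "zero_object C Z'" and g: "g \<in> Hom C X Z'"
    and h: "h \<in> Hom C Z' Y" and f: "f = h \<cdot> g"
    using f fXY unfolding zero_arrow_def by (auto simp: Hom_iff)
  obtain i where i: "i \<in> Hom C Z' Z" using zero_objectD(2)[OF Z zero_objectD(1)[OF Z']] by blast
  obtain j where j: "j \<in> Hom C Z Z'" using zero_objectD(3)[OF Z zero_objectD(1)[OF Z']] by blast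
  have "j \<cdot> i \<in> Hom C Z' Z'" "Idn C Z' \<in> Hom C Z' Z'"
    using comp_in[OF i j] idn_in Z' by (auto simp: zero_object_def)
  then have "j \<cdot> i = Idn C Z'" using zero_objectD(2)[OF Z' zero_objectD(1)[OF Z']] by blast
  then have "f = (h \<cdot> j) \<cdot> (i \<cdot> g)"
    using f comp_assoc[OF comp_in[OF g i] j h] comp_assoc[OF g i j] idn_left_Hom[OF g] by simp
  then show thesis using that comp_in[OF g i] comp_in[OF j h] by blast
qed

lemma zero_arrow_unique:
  assumes "zero_arrow C f" "zero_arrow C g" "f \<in> Hom C X Y" "g \<in> Hom C X Y"
  shows "f = g"
proof -
  obtain Z where Z: "zero_object C Z" using assms(1) unfolding zero_arrow_def by blast
  obtain a b where ab: "a \<in> Hom C X Z" "b \<in> Hom C Z Y" "f = b \<cdot> a"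
    using zero_arrow_through[OF Z assms(1,3)] .
  obtain c d where cd: "c \<in> Hom C X Z" "d \<in> Hom C Z Y" "g = d \<cdot> c"
    using zero_arrow_through[OF Z assms(2,4)] .
  have "a = c" using ab(1) cd(1) zero_objectD(2)[OF Z, of X] Hom_Obj[OF ab(1)] by blast
  moreover have "b = d" using ab(2) cd(2) zero_objectD(3)[OF Z, of Y] Hom_Obj[OF ab(2)] by blast
  ultimately show ?thesis using ab cd by simp
qed

lemma zero_arrow_exists:
  assumes "zero_object C Z" "X \<in> Obj C" "Y \<in> Obj C"
  obtains f where "f \<in> Hom C X Y" "zero_arrow C f"
proof -
  obtain g where g: "g \<in> Hom C X Z" using zero_objectD(2)[OF assms(1,2)] by blast
  obtain h where h: "h \<in> Hom C Z Y" using zero_objectD(3)[OF assms(1,3)] by blast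
  show thesis using that[OF comp_in[OF g h] zero_arrowI[OF assms(1) g h]] .
qed

lemma zero_arrow_comp_right:
  assumes "zero_arrow C f" "f \<in> Hom C Y Z" "g \<in> Hom C X Y"
  shows "zero_arrow C (f \<cdot> g)"
proof -
  obtain O' a b where O': "zero_object C O'" and ab: "a \<in> Hom C Y O'" "b \<in> Hom C O' Z" "f = b \<cdot> a"
    using assms unfolding zero_arrow_def by (auto simp: Hom_iff)
  then have "f \<cdot> g = b \<cdot> (a \<cdot> g)" using comp_assoc[OF assms(3)] by simp
  then show ?thesis unfolding zero_arrow_def
    using O' comp_in[OF assms(3) ab(1)] ab(2) comp_in[OF assms(3,2)]
    by (auto simp: Hom_iff)
qed

lemma zero_arrow_comp_left:
  assumes "zero_arrow C f" "f \<in> Hom C X Y" "g \<in> Hom C Y Z"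
  shows "zero_arrow C (g \<cdot> f)"
proof -
  interpret op: category "opposite C" using category_opposite category_axioms .
  show ?thesis using op.zero_arrow_comp_right[of f Y X g Z] assms by simp
qed

section \<open>Kernels and kernels of cokernels\<close>

lemma kernelD:
  assumes "is_kernel C f k" "f \<in> Hom C X Y"
  shows "k \<in> Hom C (Dom C k) X" "zero_arrow C (f \<cdot> k)"
    "\<And>W g. \<lbrakk>g \<in> Hom C W X; zero_arrow C (f \<cdot> g)\<rbrakk> \<Longrightarrow> \<exists>!u. u \<in> Hom C W (Dom C k) \<and> k \<cdot> u = g"
  using assms unfolding is_kernel_def by (auto simp: Hom_iff)

text \<open>Monicity of \<open>k\<close> supplies the uniqueness of lifts, so only their existence
  remains to be checked.\<close>

lemma kernelI:
  assumes "f \<in> Hom C X Y" "k \<in> Hom C K X" "zero_arrow C (f \<cdot> k)" "is_mono C k"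
    and "\<And>W g. \<lbrakk>g \<in> Hom C W X; zero_arrow C (f \<cdot> g)\<rbrakk> \<Longrightarrow> \<exists>u. u \<in> Hom C W K \<and> k \<cdot> u = g"
  shows "is_kernel C f k"
  unfolding is_kernel_def
proof (intro conjI ballI impI)
  fix g assume g: "g \<in> Arr C" "Cod C g = Dom C f \<and> zero_arrow C (f \<cdot> g)"
  then have "g \<in> Hom C (Dom C g) X" using assms(1) by (auto simp: Hom_iff)
  with assms(5) g obtain u where "u \<in> Hom C (Dom C g) K" "k \<cdot> u = g" by blast
  then show "\<exists>!u. u \<in> Hom C (Dom C g) (Dom C k) \<and> k \<cdot> u = g"
    using mono_cancel[OF assms(4,2)] assms(2) by (auto simp: Hom_iff)
qed (use assms in \<open>auto simp: Hom_iff\<close>)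

lemma kernel_mono:
  assumes "is_kernel C f k"
  shows "is_mono C k"
proof -
  obtain X Y where f: "f \<in> Hom C X Y" using assms unfolding is_kernel_def by (auto simp: Hom_iff)
  note k = kernelD[OF assms f]
  show ?thesis
  proof (rule monoI[OF k(1)])
    fix W a b assume a: "a \<in> Hom C W (Dom C k)" and b: "b \<in> Hom C W (Dom C k)" and e: "k \<cdot> a = k \<cdot> b"
    have "zero_arrow C (f \<cdot> (k \<cdot> a))"
      using zero_arrow_comp_right[OF k(2) comp_in[OF k(1) f] a] comp_assoc[OF a k(1) f] by simp
    from k(3)[OF comp_in[OF a k(1)] this] a b e show "a = b" by metis
  qed
qed

text \<open>Since \<open>f \<cdot> k\<close> is zero, \<open>f\<close> factors through the cokernel
  \<open>c\<close> of \<open>k\<close>. Whatever \<open>c\<close> kills is then killed by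
  \<open>f\<close> as well, and so lifts through \<open>k\<close>.\<close>

lemma kernel_of_cokernel:
  assumes k: "is_kernel C f k" and c: "is_cokernel C k c"
  shows "is_kernel C c k"
proof -
  interpret op: category "opposite C" using category_opposite category_axioms .
  obtain X Y where f: "f \<in> Hom C X Y" using k unfolding is_kernel_def by (auto simp: Hom_iff)
  note K = kernelD[OF k f]
  note D = op.kernelD[OF c, of X "Dom C k", simplified, OF K(1)]
  show ?thesis
  proof (rule kernelI[OF D(1) K(1) D(2) kernel_mono[OF k]])
    fix W g assume g: "g \<in> Hom C W X" "zero_arrow C (c \<cdot> g)"
    obtain u where u: "u \<in> Hom C (Cod C c) Y" "u \<cdot> c = f"
      using D(3)[OF f K(2)] by blast
    have "f \<cdot> g = u \<cdot> (c \<cdot> g)" using comp_assoc[OF g(1) D(1) u(1)] u(2) by simp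
    then have "zero_arrow C (f \<cdot> g)"
      using zero_arrow_comp_left[OF g(2) comp_in[OF g(1) D(1)] u(1)] by simp
    then show "\<exists>u. u \<in> Hom C W (Dom C k) \<and> k \<cdot> u = g" using K(3)[OF g(1)] by blast
  qed
qed

section \<open>The order on subobjects, joins and images\<close>

lemma factors_through_trans:
  assumes fg: "factors_through C f g" and gh: "factors_through C g h" and h: "h \<in> Arr C"
  shows "factors_through C f h"
proof -
  obtain u where u: "u \<in> Hom C (Dom C f) (Dom C g)" "f = g \<cdot> u"
    using fg unfolding factors_through_def by blast
  obtain v where v: "v \<in> Hom C (Dom C g) (Dom C h)" "g = h \<cdot> v"
    using gh unfolding factors_through_def by blast
  have "f = h \<cdot> (v \<cdot> u)" using comp_assoc[OF u(1) v(1), of h "Cod C h"] u v h by (auto simp: Hom_iff)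
  then show ?thesis unfolding factors_through_def using comp_in[OF u(1) v(1)] by blast
qed

lemma factors_through_refl: "f \<in> Arr C \<Longrightarrow> factors_through C f f"
  unfolding factors_through_def using idn_right idn_in dom_in by metis

text \<open>The order on classes asks for some pair of representatives; transitivity of factoring
  makes the choice immaterial.\<close>

lemma subobject_le_iff:
  assumes m: "m \<in> Monos C X" and n: "n \<in> Monos C X"
  shows "subobject C m \<sqsubseteq>\<^bsub>Sub C X\<^esub> subobject C n \<longleftrightarrow> factors_through C m n"
proof
  assume "subobject C m \<sqsubseteq>\<^bsub>Sub C X\<^esub> subobject C n"
  then obtain m' n' where *: "factors_through C m m'" "factors_through C m' n'"
    "factors_through C n' n" "is_mono C m'" "is_mono C n'"
    unfolding Sub_def subobject_def Monos_def by auto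
  moreover have "n \<in> Arr C" "n' \<in> Arr C" using n * by (auto simp: Monos_def is_mono_def)
  ultimately show "factors_through C m n" by (meson factors_through_trans)
next
  have "m \<in> subobject C m" "n \<in> subobject C n"
    using m n factors_through_refl by (auto simp: subobject_def Monos_def is_mono_def)
  moreover assume "factors_through C m n"
  ultimately show "subobject C m \<sqsubseteq>\<^bsub>Sub C X\<^esub> subobject C n" by (auto simp: Sub_def)
qed

lemma subobject_eqI:
  assumes m: "m \<in> Monos C X" and n: "n \<in> Monos C X"
    and "factors_through C m n" "factors_through C n m"
  shows "subobject C m = subobject C n"
proof -
  have "m \<in> Arr C" "n \<in> Arr C" "Cod C m = X" "Cod C n = X"
    using m n by (auto simp: Monos_def is_mono_def)
  moreover have "p \<in> Monos C X \<Longrightarrow> p \<in> Arr C" for p by (simp add: Monos_def is_mono_def)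
  ultimately show ?thesis
    using assms(3,4) unfolding subobject_def by (auto intro: factors_through_trans)
qed

text \<open>The join \<open>\<Squnion>\<close> is a Hilbert choice among least upper bounds.
  Antisymmetry of the order on subobjects leaves only one candidate.\<close>

lemma Sub_lub_eq_join:
  assumes lub: "is_lub (Sub C X) s A"
  shows "s = \<Squnion>\<^bsub>Sub C X\<^esub> A"
proof -
  have anti: "a = b" if ab: "a \<in> carrier (Sub C X)" "b \<in> carrier (Sub C X)"
    "a \<sqsubseteq>\<^bsub>Sub C X\<^esub> b" "b \<sqsubseteq>\<^bsub>Sub C X\<^esub> a" for a b
  proof -
    obtain m n where "m \<in> Monos C X" "n \<in> Monos C X" "a = subobject C m" "b = subobject C n"
      using ab(1,2) unfolding carrier_Sub by blast
    then show ?thesis using ab subobject_le_iff subobject_eqI by metis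
  qed
  have "is_lub (Sub C X) (\<Squnion>\<^bsub>Sub C X\<^esub> A) A"
    unfolding sup_def using lub by (rule someI)
  with lub show ?thesis unfolding least_def Upper_def by (intro anti) blast+
qed

text \<open>Connects the image, a set of kernels of cokernels, with the equivalence classes that
  form the carrier of \<open>Sub\<close>. Two cokernels of \<open>f\<close> factor through each
  other, hence so do their kernels; conversely a monomorphism equivalent to \<open>k\<close> is
  itself a kernel of \<open>c\<close>.\<close>

lemma image_subobject_eq:
  assumes c: "is_cokernel C f c" and k: "is_kernel C c k"
  shows "image_subobject C f = subobject C k"
proof -
  interpret op: category "opposite C" using category_opposite category_axioms .
  obtain X Y where f: "f \<in> Hom C X Y" using c unfolding is_kernel_def by (auto simp: Hom_iff)
  note D = op.kernelD[OF c, of Y X, simplified, OF f]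
  note K = kernelD[OF k D(1)]
  have factor: "factors_through C m m'"
    if c: "is_cokernel C f c" and k: "is_kernel C c m"
      and c': "is_cokernel C f c'" and k': "is_kernel C c' m'" for c m c' m'
  proof -
    note D = op.kernelD[OF c, of Y X, simplified, OF f]
    note D' = op.kernelD[OF c', of Y X, simplified, OF f]
    note K = kernelD[OF k D(1)]
    note K' = kernelD[OF k' D'(1)]
    obtain u where u: "u \<in> Hom C (Cod C c) (Cod C c')" "u \<cdot> c = c'" using D(3)[OF D'(1,2)] by blast
    have "zero_arrow C (c' \<cdot> m)"
      using zero_arrow_comp_left[OF K(2) comp_in[OF K(1) D(1)] u(1)] comp_assoc[OF K(1) D(1) u(1)] u(2)
      by simp
    then show ?thesis using K'(3)[OF K(1)] unfolding factors_through_def by blast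
  qed
  show ?thesis
  proof (intro Set.set_eqI iffI)
    fix m assume "m \<in> image_subobject C f"
    then obtain c' where c': "is_cokernel C f c'" "is_kernel C c' m" unfolding image_subobject_def by blast
    have "Cod C m = Cod C k"
      using c' c k unfolding is_kernel_def by auto
    then show "m \<in> subobject C k" unfolding subobject_def Monos_def
      using factor[OF c k c'] factor[OF c' c k] kernel_mono[OF c'(2)] by simp
  next
    fix m assume m: "m \<in> subobject C k"
    then obtain a b where ab: "a \<in> Hom C (Dom C m) (Dom C k)" "m = k \<cdot> a"
      "b \<in> Hom C (Dom C k) (Dom C m)" "k = m \<cdot> b" and mono: "is_mono C m" and Cod: "Cod C m = Cod C k"
      unfolding subobject_def Monos_def factors_through_def by blast
    have mH: "m \<in> Hom C (Dom C m) Y" using mono Cod K(1) unfolding is_mono_def by (auto simp: Hom_iff)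
    have "zero_arrow C (c \<cdot> m)"
      using zero_arrow_comp_right[OF K(2) comp_in[OF K(1) D(1)] ab(1)] comp_assoc[OF ab(1) K(1) D(1)] ab(2)
      by simp
    moreover have "\<exists>u. u \<in> Hom C W (Dom C m) \<and> m \<cdot> u = g"
      if g: "g \<in> Hom C W Y" "zero_arrow C (c \<cdot> g)" for W g
    proof -
      obtain v where v: "v \<in> Hom C W (Dom C k)" "k \<cdot> v = g" using K(3)[OF g] by blast
      have "m \<cdot> (b \<cdot> v) = g" using comp_assoc[OF v(1) ab(3) mH] ab(4) v(2) by simp
      then show ?thesis using comp_in[OF v(1) ab(3)] by blast
    qed
    ultimately have "is_kernel C c m" using kernelI[OF D(1) mH _ mono] by blast
    then show "m \<in> image_subobject C f" using c unfolding image_subobject_def by blast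
  qed
qed

lemma factors_through_image:
  assumes c: "is_cokernel C f c" and k: "is_kernel C c k"
  shows "factors_through C f k"
proof -
  have f: "f \<in> Hom C (Dom C f) (Cod C f)" using c unfolding is_kernel_def by (auto simp: Hom_iff)
  have "c \<in> Hom C (Cod C f) (Cod C c)" "zero_arrow C (c \<cdot> f)"
    using c unfolding is_kernel_def by (auto simp: Hom_iff)
  then show ?thesis using kernelD(3)[OF k _ f] unfolding factors_through_def by blast
qed

text \<open>Minimality of the image. If \<open>f\<close> factors through the kernel \<open>m\<close>
  of \<open>g\<close>, then \<open>g\<close> kills \<open>f\<close> and so factors through the
  cokernel \<open>c\<close>; thus \<open>g\<close> kills \<open>k\<close>, and \<open>k\<close>
  lifts through \<open>m\<close>. The argument needs \<open>m\<close> to be a kernel and not merely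
  monic.\<close>

lemma image_factors_through_kernel:
  assumes c: "is_cokernel C f c" and k: "is_kernel C c k"
    and m: "is_kernel C g m" and fm: "factors_through C f m"
  shows "factors_through C k m"
proof -
  interpret op: category "opposite C" using category_opposite category_axioms .
  obtain X Y where f: "f \<in> Hom C X Y" using c unfolding is_kernel_def by (auto simp: Hom_iff)
  note D = op.kernelD[OF c, of Y X, simplified, OF f]
  note K = kernelD[OF k D(1)]
  obtain u where u: "u \<in> Hom C X (Dom C m)" "f = m \<cdot> u"
    using fm f unfolding factors_through_def by (auto simp: Hom_iff)
  have mArr: "m \<in> Arr C" using m unfolding is_kernel_def by simp
  then have "Cod C f = Cod C m" using u comp_in[OF u(1), of m "Cod C m"] by (auto simp: Hom_iff)
  then obtain Z where g: "g \<in> Hom C Y Z" using m f unfolding is_kernel_def by (auto simp: Hom_iff)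
  note M = kernelD[OF m g]
  have "zero_arrow C (g \<cdot> f)"
    using zero_arrow_comp_right[OF M(2) comp_in[OF M(1) g] u(1)] comp_assoc[OF u(1) M(1) g] u(2) by simp
  then obtain v where v: "v \<in> Hom C (Cod C c) Z" "v \<cdot> c = g" using D(3)[OF g] by blast
  have "zero_arrow C (g \<cdot> k)"
    using zero_arrow_comp_left[OF K(2) comp_in[OF K(1) D(1)] v(1)] comp_assoc[OF K(1) D(1) v(1)] v(2)
    by simp
  then show ?thesis using M(3)[OF K(1)] unfolding factors_through_def by blast
qed

end

section \<open>Functor categories\<close>

lemma functorD:
  assumes "is_functor J C F"
  shows "X \<in> Obj J \<Longrightarrow> ObjMap F X \<in> Obj C"
    and "f \<in> Hom J X Y \<Longrightarrow> ArrMap F f \<in> Hom C (ObjMap F X) (ObjMap F Y)"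
    and "X \<in> Obj J \<Longrightarrow> ArrMap F (Idn J X) = Idn C (ObjMap F X)"
    and "\<lbrakk>f \<in> Hom J X Y; g \<in> Hom J Y Z\<rbrakk> \<Longrightarrow>
      ArrMap F (g \<cdot>\<^bsub>J\<^esub> f) = ArrMap F g \<cdot>\<^bsub>C\<^esub> ArrMap F f"
  using assms unfolding is_functor_def by (auto simp: Hom_iff)

lemma ntransD:
  assumes "is_ntrans J C t"
  shows "is_functor J C (Src t)" "is_functor J C (Tgt t)"
    and "X \<in> Obj J \<Longrightarrow> Cmp t X \<in> Hom C (ObjMap (Src t) X) (ObjMap (Tgt t) X)"
    and "f \<in> Hom J X Y \<Longrightarrow>
      Cmp t Y \<cdot>\<^bsub>C\<^esub> ArrMap (Src t) f = ArrMap (Tgt t) f \<cdot>\<^bsub>C\<^esub> Cmp t X"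
  using assms unfolding is_ntrans_def by (auto simp: Hom_iff)

lemma Fun_simps [simp]:
  "Obj (Fun J C) = {F. is_functor J C F}" "Arr (Fun J C) = {t. is_ntrans J C t}"
  "Dom (Fun J C) = Src" "Cod (Fun J C) = Tgt"
  "Idn (Fun J C) F = \<lparr>Src = F, Tgt = F, Cmp = (\<lambda>X\<in>Obj J. Idn C (ObjMap F X))\<rparr>"
  "s \<cdot>\<^bsub>Fun J C\<^esub> t = \<lparr>Src = Src t, Tgt = Tgt s, Cmp = (\<lambda>X\<in>Obj J. Cmp s X \<cdot>\<^bsub>C\<^esub> Cmp t X)\<rparr>"
  by (simp_all add: Fun_def)

lemma Hom_Fun: "t \<in> Hom (Fun J C) F G \<longleftrightarrow> is_ntrans J C t \<and> Src t = F \<and> Tgt t = G"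
  by (simp add: Hom_iff)

text \<open>Components are \<open>extensional\<close>, so agreement on the objects of
  \<open>J\<close> already gives equality of the HOL functions.\<close>

lemma ntrans_eqI:
  assumes "s \<in> Hom (Fun J C) F G" "t \<in> Hom (Fun J C) F G"
    and "\<And>X. X \<in> Obj J \<Longrightarrow> Cmp s X = Cmp t X"
  shows "s = t"
proof -
  have "Cmp s = Cmp t"
    using assms unfolding Hom_Fun is_ntrans_def by (intro extensionalityI[of _ "Obj J"]) auto
  then show ?thesis using assms(1,2) by (simp add: Hom_Fun)
qed

locale category_pair = J: category J + C: category C
  for J :: "('i, 'j) cat" and C :: "('o, 'a) cat"
begin

lemma functorI:
  assumes "\<And>X. X \<in> Obj J \<Longrightarrow> F X \<in> Obj C"
    and "\<And>f X Y. f \<in> Hom J X Y \<Longrightarrow> A f \<in> Hom C (F X) (F Y)"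
    and "\<And>X. X \<in> Obj J \<Longrightarrow> A (Idn J X) = Idn C (F X)"
    and "\<And>f g X Y Z. \<lbrakk>f \<in> Hom J X Y; g \<in> Hom J Y Z\<rbrakk> \<Longrightarrow> A (g \<cdot>\<^bsub>J\<^esub> f) = A g \<cdot>\<^bsub>C\<^esub> A f"
  shows "is_functor J C \<lparr>ObjMap = restrict F (Obj J), ArrMap = restrict A (Arr J)\<rparr>"
proof -
  have A: "A f \<in> Hom C (F (Dom J f)) (F (Cod J f))" if "f \<in> Arr J" for f
    using that assms(2) by (simp add: Hom_iff)
  have I: "Idn J X \<in> Arr J" if "X \<in> Obj J" for X using J.idn_in[OF that] by (simp add: Hom_iff)
  have c: "g \<cdot>\<^bsub>J\<^esub> f \<in> Arr J \<and> A (g \<cdot>\<^bsub>J\<^esub> f) = A g \<cdot>\<^bsub>C\<^esub> A f"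
    if "f \<in> Arr J" "g \<in> Arr J" "Dom J g = Cod J f" for f g
  proof -
    have "f \<in> Hom J (Dom J f) (Cod J f)" "g \<in> Hom J (Cod J f) (Cod J g)"
      using that by (simp_all add: Hom_iff)
    then show ?thesis using assms(4) J.comp_in by (metis Hom_iff)
  qed
  show ?thesis unfolding is_functor_def
    using A assms(1,3) J.dom_in J.cod_in I c by (auto simp: Hom_iff)
qed

lemma ntransI:
  assumes "is_functor J C F" "is_functor J C G"
    and "\<And>X. X \<in> Obj J \<Longrightarrow> t X \<in> Hom C (ObjMap F X) (ObjMap G X)"
    and "\<And>f X Y. f \<in> Hom J X Y \<Longrightarrow> t Y \<cdot>\<^bsub>C\<^esub> ArrMap F f = ArrMap G f \<cdot>\<^bsub>C\<^esub> t X"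
  shows "\<lparr>Src = F, Tgt = G, Cmp = restrict t (Obj J)\<rparr> \<in> Hom (Fun J C) F G"
  using assms J.dom_in J.cod_in unfolding Hom_Fun is_ntrans_def by (auto simp: Hom_iff)

lemma Hom_FunD:
  assumes "t \<in> Hom (Fun J C) F G"
  shows "is_functor J C F" "is_functor J C G"
    and "X \<in> Obj J \<Longrightarrow> Cmp t X \<in> Hom C (ObjMap F X) (ObjMap G X)"
    and "f \<in> Hom J X Y \<Longrightarrow> Cmp t Y \<cdot>\<^bsub>C\<^esub> ArrMap F f = ArrMap G f \<cdot>\<^bsub>C\<^esub> Cmp t X"
  using assms ntransD[of J C t] unfolding Hom_Fun by auto

lemma category_Fun: "category (Fun J C)"
proof
  fix F assume "F \<in> Obj (Fun J C)"
  then have F: "is_functor J C F" by simp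
  show "Idn (Fun J C) F \<in> Hom (Fun J C) F F"
    unfolding Fun_simps using F
  proof (rule ntransI[OF F])
    fix f X Y assume f: "f \<in> Hom J X Y"
    show "Idn C (ObjMap F Y) \<cdot>\<^bsub>C\<^esub> ArrMap F f = ArrMap F f \<cdot>\<^bsub>C\<^esub> Idn C (ObjMap F X)"
      using functorD(2)[OF F f] by (simp add: C.idn_left_Hom C.idn_right_Hom)
  qed (use functorD(1)[OF F] C.idn_in in blast)
next
  fix s t F G H assume s: "s \<in> Hom (Fun J C) F G" and t: "t \<in> Hom (Fun J C) G H"
  note s' = Hom_FunD[OF s] and t' = Hom_FunD[OF t]
  have "\<lparr>Src = F, Tgt = H, Cmp = (\<lambda>X\<in>Obj J. Cmp t X \<cdot>\<^bsub>C\<^esub> Cmp s X)\<rparr> \<in> Hom (Fun J C) F H"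
  proof (rule ntransI[OF s'(1) t'(2)])
    show "Cmp t X \<cdot>\<^bsub>C\<^esub> Cmp s X \<in> Hom C (ObjMap F X) (ObjMap H X)" if "X \<in> Obj J" for X
      using C.comp_in[OF s'(3)[OF that] t'(3)[OF that]] .
    fix f X Y assume f: "f \<in> Hom J X Y"
    then have X: "X \<in> Obj J" and Y: "Y \<in> Obj J" using J.Hom_Obj by auto
    note F = functorD(2)[OF s'(1) f] and G = functorD(2)[OF s'(2) f] and H = functorD(2)[OF t'(2) f]
    have "(Cmp t Y \<cdot>\<^bsub>C\<^esub> Cmp s Y) \<cdot>\<^bsub>C\<^esub> ArrMap F f = Cmp t Y \<cdot>\<^bsub>C\<^esub> (ArrMap G f \<cdot>\<^bsub>C\<^esub> Cmp s X)"
      using C.comp_assoc[OF F s'(3)[OF Y] t'(3)[OF Y]] s'(4)[OF f] by simp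
    also have "\<dots> = (ArrMap H f \<cdot>\<^bsub>C\<^esub> Cmp t X) \<cdot>\<^bsub>C\<^esub> Cmp s X"
      using C.comp_assoc[OF s'(3)[OF X] G t'(3)[OF Y]] t'(4)[OF f] by simp
    also have "\<dots> = ArrMap H f \<cdot>\<^bsub>C\<^esub> (Cmp t X \<cdot>\<^bsub>C\<^esub> Cmp s X)"
      using C.comp_assoc[OF s'(3)[OF X] t'(3)[OF X] H] .
    finally show "(Cmp t Y \<cdot>\<^bsub>C\<^esub> Cmp s Y) \<cdot>\<^bsub>C\<^esub> ArrMap F f
      = ArrMap H f \<cdot>\<^bsub>C\<^esub> (Cmp t X \<cdot>\<^bsub>C\<^esub> Cmp s X)" .
  qed
  then show "t \<cdot>\<^bsub>Fun J C\<^esub> s \<in> Hom (Fun J C) F H" using s t by (simp add: Hom_Fun)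
next
  fix t assume "t \<in> Arr (Fun J C)"
  then have t: "t \<in> Hom (Fun J C) (Src t) (Tgt t)" by (simp add: Hom_Fun)
  have "Cmp t \<in> extensional (Obj J)" using t by (simp add: Hom_Fun is_ntrans_def)
  moreover have "Cmp t X \<cdot>\<^bsub>C\<^esub> Idn C (ObjMap (Src t) X) = Cmp t X"
    and "Idn C (ObjMap (Tgt t) X) \<cdot>\<^bsub>C\<^esub> Cmp t X = Cmp t X" if "X \<in> Obj J" for X
    using C.idn_left_Hom C.idn_right_Hom Hom_FunD(3)[OF t that] by auto
  ultimately show "t \<cdot>\<^bsub>Fun J C\<^esub> Idn (Fun J C) (Dom (Fun J C) t) = t"
    and "Idn (Fun J C) (Cod (Fun J C) t) \<cdot>\<^bsub>Fun J C\<^esub> t = t"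
    by (auto intro!: ntrans.equality extensionalityI[of _ "Obj J"])
next
  fix r s t F G H K
  assume r: "r \<in> Hom (Fun J C) F G" and s: "s \<in> Hom (Fun J C) G H" and t: "t \<in> Hom (Fun J C) H K"
  show "(t \<cdot>\<^bsub>Fun J C\<^esub> s) \<cdot>\<^bsub>Fun J C\<^esub> r = t \<cdot>\<^bsub>Fun J C\<^esub> (s \<cdot>\<^bsub>Fun J C\<^esub> r)"
    using C.comp_assoc[OF Hom_FunD(3)[OF r] Hom_FunD(3)[OF s] Hom_FunD(3)[OF t]] by auto
qed (auto dest: ntransD)

end

sublocale category_pair \<subseteq> FC: category "Fun J C"
  by (rule category_Fun)

section \<open>Monomorphisms, zero arrows and kernels of natural transformations, computed
  pointwise\<close>

context category_pair
begin

text \<open>The easy direction, valid in any category. The converse,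
  \<open>mono_Fun_component\<close>, relies on the abelian structure of the target.\<close>

lemma mono_FunI:
  assumes s: "s \<in> Hom (Fun J C) S H" and mono: "\<And>X. X \<in> Obj J \<Longrightarrow> is_mono C (Cmp s X)"
  shows "is_mono (Fun J C) s"
proof (rule FC.monoI[OF s])
  fix R f g assume f: "f \<in> Hom (Fun J C) R S" and g: "g \<in> Hom (Fun J C) R S"
    and eq: "s \<cdot>\<^bsub>Fun J C\<^esub> f = s \<cdot>\<^bsub>Fun J C\<^esub> g"
  show "f = g"
  proof (rule ntrans_eqI[OF f g])
    fix X assume X: "X \<in> Obj J"
    have "Cmp s X \<cdot>\<^bsub>C\<^esub> Cmp f X = Cmp s X \<cdot>\<^bsub>C\<^esub> Cmp g X"
      using arg_cong[OF eq, of "\<lambda>t. Cmp t X"] X by simp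
    then show "Cmp f X = Cmp g X"
      using C.mono_cancel mono Hom_FunD(3)[OF s X] Hom_FunD(3)[OF f X] Hom_FunD(3)[OF g X] X by blast
  qed
qed

text \<open>The lifts at different objects may be chosen independently of each other: the two sides
  of each naturality square agree after composition with the monic \<open>Cmp s Y\<close>, hence
  agree.\<close>

lemma ntrans_lift:
  assumes s: "s \<in> Hom (Fun J C) S H" and mono: "\<And>X. X \<in> Obj J \<Longrightarrow> is_mono C (Cmp s X)"
    and t: "t \<in> Hom (Fun J C) T H"
    and lift: "\<And>X. X \<in> Obj J \<Longrightarrow> \<exists>w \<in> Hom C (ObjMap T X) (ObjMap S X). Cmp s X \<cdot>\<^bsub>C\<^esub> w = Cmp t X"
  shows "\<exists>w. w \<in> Hom (Fun J C) T S \<and> s \<cdot>\<^bsub>Fun J C\<^esub> w = t"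
proof -
  obtain w where w: "\<And>X. X \<in> Obj J \<Longrightarrow> w X \<in> Hom C (ObjMap T X) (ObjMap S X)"
    and sw: "\<And>X. X \<in> Obj J \<Longrightarrow> Cmp s X \<cdot>\<^bsub>C\<^esub> w X = Cmp t X"
    using lift by metis
  note s' = Hom_FunD[OF s] and t' = Hom_FunD[OF t]
  let ?w = "\<lparr>Src = T, Tgt = S, Cmp = restrict w (Obj J)\<rparr>"
  have "?w \<in> Hom (Fun J C) T S"
  proof (rule ntransI[OF t'(1) s'(1) w])
    fix f X Y assume f: "f \<in> Hom J X Y"
    then have X: "X \<in> Obj J" and Y: "Y \<in> Obj J" using J.Hom_Obj by auto
    note T = functorD(2)[OF t'(1) f] and S = functorD(2)[OF s'(1) f] and H = functorD(2)[OF s'(2) f]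
    have "Cmp s Y \<cdot>\<^bsub>C\<^esub> (w Y \<cdot>\<^bsub>C\<^esub> ArrMap T f) = ArrMap H f \<cdot>\<^bsub>C\<^esub> Cmp t X"
      using C.comp_assoc[OF T w[OF Y] s'(3)[OF Y]] sw[OF Y] t'(4)[OF f] by simp
    also have "\<dots> = (Cmp s Y \<cdot>\<^bsub>C\<^esub> ArrMap S f) \<cdot>\<^bsub>C\<^esub> w X"
      using C.comp_assoc[OF w[OF X] s'(3)[OF X] H] sw[OF X] s'(4)[OF f] by simp
    also have "\<dots> = Cmp s Y \<cdot>\<^bsub>C\<^esub> (ArrMap S f \<cdot>\<^bsub>C\<^esub> w X)"
      using C.comp_assoc[OF w[OF X] S s'(3)[OF Y]] .
    finally show "w Y \<cdot>\<^bsub>C\<^esub> ArrMap T f = ArrMap S f \<cdot>\<^bsub>C\<^esub> w X"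
      using C.mono_cancel[OF mono[OF Y] s'(3)[OF Y] C.comp_in[OF T w[OF Y]] C.comp_in[OF w[OF X] S]]
      by simp
  qed
  moreover from this have "s \<cdot>\<^bsub>Fun J C\<^esub> ?w = t"
    using sw by (intro ntrans_eqI[OF FC.comp_in[OF _ s] t]) auto
  ultimately show ?thesis by blast
qed

text \<open>Turns a family of monomorphisms into the components of a natural transformation. The
  action on arrows is forced, being the unique lift of \<open>ArrMap G f \<cdot> k X\<close> through
  the monic \<open>k Y\<close>; the functor laws follow from those of \<open>G\<close> by cancelling
  \<open>k\<close>.\<close>

lemma subfunctor:
  assumes G: "is_functor J C G"
    and k: "\<And>X. X \<in> Obj J \<Longrightarrow> k X \<in> Hom C (K X) (ObjMap G X)"
    and mono: "\<And>X. X \<in> Obj J \<Longrightarrow> is_mono C (k X)"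
    and lift: "\<And>f X Y. f \<in> Hom J X Y \<Longrightarrow> \<exists>u \<in> Hom C (K X) (K Y). k Y \<cdot>\<^bsub>C\<^esub> u = ArrMap G f \<cdot>\<^bsub>C\<^esub> k X"
  obtains F s where "s \<in> Hom (Fun J C) F G" "\<And>X. X \<in> Obj J \<Longrightarrow> Cmp s X = k X"
proof -
  have "\<forall>f\<in>Arr J. \<exists>u. u \<in> Hom C (K (Dom J f)) (K (Cod J f)) \<and>
      k (Cod J f) \<cdot>\<^bsub>C\<^esub> u = ArrMap G f \<cdot>\<^bsub>C\<^esub> k (Dom J f)"
    using lift by (metis Hom_iff)
  then obtain u where u: "\<And>f. f \<in> Arr J \<Longrightarrow> u f \<in> Hom C (K (Dom J f)) (K (Cod J f)) \<and>
      k (Cod J f) \<cdot>\<^bsub>C\<^esub> u f = ArrMap G f \<cdot>\<^bsub>C\<^esub> k (Dom J f)"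
    by metis
  have uH: "u f \<in> Hom C (K X) (K Y)" and ku: "k Y \<cdot>\<^bsub>C\<^esub> u f = ArrMap G f \<cdot>\<^bsub>C\<^esub> k X"
    if "f \<in> Hom J X Y" for f X Y
    using u[of f] that by (auto simp: Hom_iff)
  let ?F = "\<lparr>ObjMap = restrict K (Obj J), ArrMap = restrict u (Arr J)\<rparr>"
  have F: "is_functor J C ?F"
  proof (rule functorI[OF _ uH])
    show "K X \<in> Obj C" if "X \<in> Obj J" for X using k[OF that] C.Hom_Obj by blast
    show "u (Idn J X) = Idn C (K X)" if X: "X \<in> Obj J" for X
    proof (rule C.mono_cancel[OF mono[OF X] k[OF X] uH[OF J.idn_in[OF X]]])
      show "Idn C (K X) \<in> Hom C (K X) (K X)" using k[OF X] C.Hom_Obj C.idn_in by blast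
      show "k X \<cdot>\<^bsub>C\<^esub> u (Idn J X) = k X \<cdot>\<^bsub>C\<^esub> Idn C (K X)"
        using ku[OF J.idn_in[OF X]] functorD(3)[OF G X] k[OF X]
        by (simp add: C.idn_left_Hom C.idn_right_Hom)
    qed
    fix f g X Y Z assume f: "f \<in> Hom J X Y" and g: "g \<in> Hom J Y Z"
    then have X: "X \<in> Obj J" and Y: "Y \<in> Obj J" and Z: "Z \<in> Obj J" using J.Hom_Obj by auto
    note gf = J.comp_in[OF f g]
    note Gf = functorD(2)[OF G f] and Gg = functorD(2)[OF G g]
    have "k Z \<cdot>\<^bsub>C\<^esub> u (g \<cdot>\<^bsub>J\<^esub> f) = (ArrMap G g \<cdot>\<^bsub>C\<^esub> ArrMap G f) \<cdot>\<^bsub>C\<^esub> k X"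
      using ku[OF gf] functorD(4)[OF G f g] by simp
    also have "\<dots> = ArrMap G g \<cdot>\<^bsub>C\<^esub> (k Y \<cdot>\<^bsub>C\<^esub> u f)"
      using C.comp_assoc[OF k[OF X] Gf Gg] ku[OF f] by simp
    also have "\<dots> = (k Z \<cdot>\<^bsub>C\<^esub> u g) \<cdot>\<^bsub>C\<^esub> u f"
      using C.comp_assoc[OF uH[OF f] k[OF Y] Gg] ku[OF g] by simp
    also have "\<dots> = k Z \<cdot>\<^bsub>C\<^esub> (u g \<cdot>\<^bsub>C\<^esub> u f)"
      using C.comp_assoc[OF uH[OF f] uH[OF g] k[OF Z]] .
    finally show "u (g \<cdot>\<^bsub>J\<^esub> f) = u g \<cdot>\<^bsub>C\<^esub> u f"
      using C.mono_cancel[OF mono[OF Z] k[OF Z] uH[OF gf] C.comp_in[OF uH[OF f] uH[OF g]]] by simp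
  qed
  have "\<lparr>Src = ?F, Tgt = G, Cmp = restrict k (Obj J)\<rparr> \<in> Hom (Fun J C) ?F G"
    using k ku J.dom_in J.cod_in by (intro ntransI[OF F G]) (auto simp: Hom_iff)
  then show thesis by (rule that) simp
qed

text \<open>\<open>K\<close> is the constant functor at \<open>Z\<close>. Every naturality square
  commutes because both of its sides are arrows into, or out of, a zero object.\<close>

lemma zero_object_Fun:
  assumes Z: "zero_object C Z"
  defines "K \<equiv> \<lparr>ObjMap = (\<lambda>X\<in>Obj J. Z), ArrMap = (\<lambda>f\<in>Arr J. Idn C Z)\<rparr>"
  shows "zero_object (Fun J C) K"
proof -
  note Zobj = zero_objectD(1)[OF Z]
  have K: "is_functor J C K" unfolding K_def
    using Zobj C.idn_in by (intro functorI) (auto simp: C.idn_left_Hom[OF C.idn_in])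
  have KX: "ObjMap K X = Z" if "X \<in> Obj J" for X using that by (simp add: K_def)
  have uniqueZ: "f = g" if "f \<in> Hom C X Z \<and> g \<in> Hom C X Z \<or> f \<in> Hom C Z X \<and> g \<in> Hom C Z X" for f g X
    using that zero_objectD(2,3)[OF Z] C.Hom_Obj by blast
  have "\<exists>!t. t \<in> Hom (Fun J C) F K" if "F \<in> Obj (Fun J C)" for F
  proof (rule ex_ex1I)
    have F: "is_functor J C F" using that by simp
    have "\<forall>X\<in>Obj J. \<exists>f. f \<in> Hom C (ObjMap F X) Z"
      using zero_objectD(2)[OF Z] functorD(1)[OF F] by blast
    then obtain t where t: "\<And>X. X \<in> Obj J \<Longrightarrow> t X \<in> Hom C (ObjMap F X) Z" by metis
    have "\<lparr>Src = F, Tgt = K, Cmp = restrict t (Obj J)\<rparr> \<in> Hom (Fun J C) F K"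
    proof (rule ntransI[OF F K])
      fix f X Y assume f: "f \<in> Hom J X Y"
      then have X: "X \<in> Obj J" and Y: "Y \<in> Obj J" using J.Hom_Obj by auto
      show "t Y \<cdot>\<^bsub>C\<^esub> ArrMap F f = ArrMap K f \<cdot>\<^bsub>C\<^esub> t X"
        using C.comp_in[OF functorD(2)[OF F f] t[OF Y]] C.comp_in[OF t[OF X], of "ArrMap K f" Z]
          functorD(2)[OF K f] KX[OF X] KX[OF Y] by (intro uniqueZ) auto
    qed (use t KX in simp)
    then show "\<exists>t. t \<in> Hom (Fun J C) F K" ..
    show "s = t" if s: "s \<in> Hom (Fun J C) F K" and t: "t \<in> Hom (Fun J C) F K" for s t
      using Hom_FunD(3)[OF s] Hom_FunD(3)[OF t] KX uniqueZ by (intro ntrans_eqI[OF s t]) metis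
  qed
  moreover have "\<exists>!t. t \<in> Hom (Fun J C) K F" if "F \<in> Obj (Fun J C)" for F
  proof (rule ex_ex1I)
    have F: "is_functor J C F" using that by simp
    have "\<forall>X\<in>Obj J. \<exists>f. f \<in> Hom C Z (ObjMap F X)"
      using zero_objectD(3)[OF Z] functorD(1)[OF F] by blast
    then obtain t where t: "\<And>X. X \<in> Obj J \<Longrightarrow> t X \<in> Hom C Z (ObjMap F X)" by metis
    have "\<lparr>Src = K, Tgt = F, Cmp = restrict t (Obj J)\<rparr> \<in> Hom (Fun J C) K F"
    proof (rule ntransI[OF K F])
      fix f X Y assume f: "f \<in> Hom J X Y"
      then have X: "X \<in> Obj J" and Y: "Y \<in> Obj J" using J.Hom_Obj by auto
      show "t Y \<cdot>\<^bsub>C\<^esub> ArrMap K f = ArrMap F f \<cdot>\<^bsub>C\<^esub> t X"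
        using C.comp_in[OF t[OF X] functorD(2)[OF F f]] C.comp_in[of "ArrMap K f" Z Z, OF _ t[OF Y]]
          functorD(2)[OF K f] KX[OF X] KX[OF Y] by (intro uniqueZ) auto
    qed (use t KX in simp)
    then show "\<exists>t. t \<in> Hom (Fun J C) K F" ..
    show "s = t" if s: "s \<in> Hom (Fun J C) K F" and t: "t \<in> Hom (Fun J C) K F" for s t
      using Hom_FunD(3)[OF s] Hom_FunD(3)[OF t] KX uniqueZ by (intro ntrans_eqI[OF s t]) metis
  qed
  ultimately show ?thesis using K by (simp add: zero_object_def)
qed

lemma zero_arrow_Fun_iff:
  assumes Z: "zero_object C Z" and t: "t \<in> Hom (Fun J C) F G"
  shows "zero_arrow (Fun J C) t \<longleftrightarrow> (\<forall>X\<in>Obj J. zero_arrow C (Cmp t X))"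
proof -
  note ZF = zero_object_Fun[OF Z]
  have pointwise: "zero_arrow C (Cmp s X)"
    if s: "zero_arrow (Fun J C) s" "s \<in> Hom (Fun J C) F G" and X: "X \<in> Obj J" for s X
  proof -
    obtain a b where a: "a \<in> Hom (Fun J C) F \<lparr>ObjMap = (\<lambda>X\<in>Obj J. Z), ArrMap = (\<lambda>f\<in>Arr J. Idn C Z)\<rparr>"
      and b: "b \<in> Hom (Fun J C) \<lparr>ObjMap = (\<lambda>X\<in>Obj J. Z), ArrMap = (\<lambda>f\<in>Arr J. Idn C Z)\<rparr> G"
      and ab: "s = b \<cdot>\<^bsub>Fun J C\<^esub> a"
      using FC.zero_arrow_through[OF ZF s] .
    have "Cmp s X = Cmp b X \<cdot>\<^bsub>C\<^esub> Cmp a X" using ab X by simp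
    moreover have "Cmp a X \<in> Hom C (ObjMap F X) Z" "Cmp b X \<in> Hom C Z (ObjMap G X)"
      using Hom_FunD(3)[OF a X] Hom_FunD(3)[OF b X] X by auto
    ultimately show ?thesis using C.zero_arrowI[OF Z] by simp
  qed
  show ?thesis
  proof
    \<comment> \<open>No factorization of \<open>t\<close> is built. The zero transformation
      \<open>s\<close> with the same source and target has zero components too, so uniqueness of
      zero arrows identifies it with \<open>t\<close>.\<close>
    assume *: "\<forall>X\<in>Obj J. zero_arrow C (Cmp t X)"
    obtain s where s: "s \<in> Hom (Fun J C) F G" "zero_arrow (Fun J C) s"
      using FC.zero_arrow_exists[OF ZF, of F G] Hom_FunD(1,2)[OF t] by auto
    have "s = t"
      using pointwise[OF s(2,1)] * Hom_FunD(3)[OF s(1)] Hom_FunD(3)[OF t] C.zero_arrow_unique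
      by (intro ntrans_eqI[OF s(1) t]) blast
    then show "zero_arrow (Fun J C) t" using s by simp
  qed (use pointwise t in blast)
qed

lemma kernel_FunI:
  assumes Z: "zero_object C Z" and t: "t \<in> Hom (Fun J C) F G" and k: "k \<in> Hom (Fun J C) K F"
    and ker: "\<And>X. X \<in> Obj J \<Longrightarrow> is_kernel C (Cmp t X) (Cmp k X)"
  shows "is_kernel (Fun J C) t k"
proof -
  have mono: "is_mono C (Cmp k X)" if "X \<in> Obj J" for X using C.kernel_mono[OF ker[OF that]] .
  show ?thesis
  proof (rule FC.kernelI[OF t k _ mono_FunI[OF k mono]])
    show "zero_arrow (Fun J C) (t \<cdot>\<^bsub>Fun J C\<^esub> k)"
      using C.kernelD(2)[OF ker Hom_FunD(3)[OF t]]
      by (subst zero_arrow_Fun_iff[OF Z FC.comp_in[OF k t]]) auto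
    fix H g assume g: "g \<in> Hom (Fun J C) H F" "zero_arrow (Fun J C) (t \<cdot>\<^bsub>Fun J C\<^esub> g)"
    show "\<exists>u. u \<in> Hom (Fun J C) H K \<and> k \<cdot>\<^bsub>Fun J C\<^esub> u = g"
    proof (rule ntrans_lift[OF k mono g(1)])
      fix X assume X: "X \<in> Obj J"
      have "zero_arrow C (Cmp t X \<cdot>\<^bsub>C\<^esub> Cmp g X)"
        using g(2) X zero_arrow_Fun_iff[OF Z FC.comp_in[OF g(1) t]] by auto
      then have "\<exists>!u. u \<in> Hom C (ObjMap H X) (Dom C (Cmp k X)) \<and> Cmp k X \<cdot>\<^bsub>C\<^esub> u = Cmp g X"
        using C.kernelD(3)[OF ker[OF X] Hom_FunD(3)[OF t X] Hom_FunD(3)[OF g(1) X]] by blast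
      moreover have "Dom C (Cmp k X) = ObjMap K X" using Hom_FunD(3)[OF k X] by (simp add: Hom_iff)
      ultimately show "\<exists>w\<in>Hom C (ObjMap H X) (ObjMap K X). Cmp k X \<cdot>\<^bsub>C\<^esub> w = Cmp g X"
        by auto
    qed
  qed
qed

text \<open>Naturality of \<open>t\<close> makes \<open>Cmp t Y\<close> kill
  \<open>ArrMap F f \<cdot> k X\<close>, so the chosen pointwise kernels form a subfunctor of
  \<open>F\<close>. The pointwise description is returned along with the kernel because arguments
  about components need this particular kernel.\<close>

lemma kernel_Fun_exists:
  assumes Z: "zero_object C Z" and t: "t \<in> Hom (Fun J C) F G"
    and ker: "\<And>f. f \<in> Arr C \<Longrightarrow> \<exists>k. is_kernel C f k"
  obtains k where "is_kernel (Fun J C) t k" "\<And>X. X \<in> Obj J \<Longrightarrow> is_kernel C (Cmp t X) (Cmp k X)"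
proof -
  note t' = Hom_FunD[OF t]
  have "\<forall>X\<in>Obj J. \<exists>k. is_kernel C (Cmp t X) k" using ker t'(3) by (simp add: Hom_iff)
  then obtain k where k: "\<And>X. X \<in> Obj J \<Longrightarrow> is_kernel C (Cmp t X) (k X)" by metis
  note K = C.kernelD[OF k t'(3)]
  obtain K s where s: "s \<in> Hom (Fun J C) K F" "\<And>X. X \<in> Obj J \<Longrightarrow> Cmp s X = k X"
  proof (rule subfunctor[OF t'(1), of k "\<lambda>X. Dom C (k X)"])
    fix f X Y assume f: "f \<in> Hom J X Y"
    then have X: "X \<in> Obj J" and Y: "Y \<in> Obj J" using J.Hom_Obj by auto
    note F = functorD(2)[OF t'(1) f] and G = functorD(2)[OF t'(2) f]
    note kX = K(1)[OF X X]
    have "Cmp t Y \<cdot>\<^bsub>C\<^esub> (ArrMap F f \<cdot>\<^bsub>C\<^esub> k X) = ArrMap G f \<cdot>\<^bsub>C\<^esub> (Cmp t X \<cdot>\<^bsub>C\<^esub> k X)"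
      using C.comp_assoc[OF kX F t'(3)[OF Y]] C.comp_assoc[OF kX t'(3)[OF X] G] t'(4)[OF f] by simp
    then have "zero_arrow C (Cmp t Y \<cdot>\<^bsub>C\<^esub> (ArrMap F f \<cdot>\<^bsub>C\<^esub> k X))"
      using C.zero_arrow_comp_left[OF K(2)[OF X X] C.comp_in[OF kX t'(3)[OF X]] G] by simp
    then show "\<exists>u\<in>Hom C (Dom C (k X)) (Dom C (k Y)). k Y \<cdot>\<^bsub>C\<^esub> u = ArrMap F f \<cdot>\<^bsub>C\<^esub> k X"
      using K(3)[OF Y Y C.comp_in[OF kX F]] by blast
  qed (use K(1) C.kernel_mono[OF k] in blast)+
  have "is_kernel C (Cmp t X) (Cmp s X)" if "X \<in> Obj J" for X using k s(2) that by simp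
  then show thesis using that kernel_FunI[OF Z t s(1)] by blast
qed

end

text \<open>The categories \<open>opposite (Fun J C)\<close> and \<open>Fun (opposite J) (opposite C)\<close> have the same
  objects and are isomorphic through the following map on arrows.\<close>

definition op_ntrans :: "('i, 'j, 'o, 'a) ntrans \<Rightarrow> ('i, 'j, 'o, 'a) ntrans" where
  "op_ntrans t = \<lparr>Src = Tgt t, Tgt = Src t, Cmp = Cmp t\<rparr>"

lemma op_ntrans_simps [simp]:
  "Src (op_ntrans t) = Tgt t" "Tgt (op_ntrans t) = Src t" "Cmp (op_ntrans t) = Cmp t"
  "op_ntrans (op_ntrans t) = t"
  by (simp_all add: op_ntrans_def)

lemma is_functor_opposite [simp]: "is_functor (opposite J) (opposite C) F = is_functor J C F"
  unfolding is_functor_def by (auto simp: Hom_iff)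

lemma Hom_op_ntrans [simp]:
  "op_ntrans t \<in> Hom (Fun (opposite J) (opposite C)) F G \<longleftrightarrow> t \<in> Hom (Fun J C) G F"
  unfolding Hom_Fun is_ntrans_def by auto

lemma op_ntrans_comp:
  "op_ntrans (s \<cdot>\<^bsub>Fun J C\<^esub> t) = op_ntrans t \<cdot>\<^bsub>Fun (opposite J) (opposite C)\<^esub> op_ntrans s"
  by (simp add: op_ntrans_def)

section \<open>Cokernels of natural transformations, by duality\<close>

context category_pair
begin

text \<open>A cokernel of \<open>t\<close> is a kernel of \<open>op_ntrans t\<close> between the
  opposite categories, carried back along \<open>op_ntrans\<close>. The bulk of the proof is this
  transport of the universal property.\<close>

lemma cokernel_Fun_exists:
  assumes Z: "zero_object C Z" and t: "t \<in> Hom (Fun J C) F G"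
    and coker: "\<And>f. f \<in> Arr C \<Longrightarrow> \<exists>c. is_cokernel C f c"
  obtains c where "is_cokernel (Fun J C) t c" "\<And>X. X \<in> Obj J \<Longrightarrow> is_cokernel C (Cmp t X) (Cmp c X)"
proof -
  interpret op: category_pair "opposite J" "opposite C"
    by (intro category_pair.intro category_opposite J.category_axioms C.category_axioms)
  interpret opFC: category "opposite (Fun J C)" by (rule category_opposite[OF FC.category_axioms])
  have t': "op_ntrans t \<in> Hom (Fun (opposite J) (opposite C)) G F" using t by simp
  have Z': "zero_object (opposite C) Z" using Z by simp
  obtain d where d: "is_kernel (Fun (opposite J) (opposite C)) (op_ntrans t) d"
    and dX: "\<And>X. X \<in> Obj J \<Longrightarrow> is_cokernel C (Cmp t X) (Cmp d X)"
    using op.kernel_Fun_exists[OF Z' t'] coker by auto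
  note D = op.FC.kernelD[OF d t']
  let ?c = "op_ntrans d"
  have c: "?c \<in> Hom (Fun J C) G (Src d)"
    using D(1) Hom_op_ntrans[of ?c J C "Src d" G] by simp
  \<comment> \<open>Both sides are tested on components, where reversing arrows does not change what
    a zero arrow is; this avoids transporting zero objects between the two functor
    categories.\<close>
  have zero: "zero_arrow (Fun (opposite J) (opposite C)) (op_ntrans s) = zero_arrow (Fun J C) s"
    if "s \<in> Hom (Fun J C) H K" for s H K
    using zero_arrow_Fun_iff[OF Z that] op.zero_arrow_Fun_iff[OF Z', of "op_ntrans s" K H] that by simp
  have "is_cokernel (Fun J C) t ?c"
  proof (rule opFC.kernelI[of t G F ?c "Src d"])
    have "zero_arrow (Fun J C) (?c \<cdot>\<^bsub>Fun J C\<^esub> t)"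
      using D(2) zero[OF FC.comp_in[OF t c]] op_ntrans_comp[of J C ?c t] by (simp del: Fun_simps)
    then show "zero_arrow (opposite (Fun J C)) (t \<cdot>\<^bsub>opposite (Fun J C)\<^esub> ?c)"
      by (simp del: Fun_simps)
    show "is_epi (Fun J C) ?c"
    proof (rule opFC.monoI[of ?c "Src d" G])
      fix H f g assume "f \<in> Hom (opposite (Fun J C)) H (Src d)" "g \<in> Hom (opposite (Fun J C)) H (Src d)"
        and eq: "?c \<cdot>\<^bsub>opposite (Fun J C)\<^esub> f = ?c \<cdot>\<^bsub>opposite (Fun J C)\<^esub> g"
      then have "op_ntrans f \<in> Hom (Fun (opposite J) (opposite C)) H (Src d)"
        "op_ntrans g \<in> Hom (Fun (opposite J) (opposite C)) H (Src d)"
        "d \<cdot>\<^bsub>Fun (opposite J) (opposite C)\<^esub> op_ntrans f = d \<cdot>\<^bsub>Fun (opposite J) (opposite C)\<^esub> op_ntrans g"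
        using op_ntrans_comp[of J C f ?c] op_ntrans_comp[of J C g ?c] by (simp_all del: Fun_simps)
      then have "op_ntrans f = op_ntrans g"
        using op.FC.mono_cancel[OF op.FC.kernel_mono[OF d]] D(1) by simp
      then show "f = g" by (metis op_ntrans_simps(4))
    qed (use c in simp)
    fix H g assume "g \<in> Hom (opposite (Fun J C)) H G"
      and z: "zero_arrow (opposite (Fun J C)) (t \<cdot>\<^bsub>opposite (Fun J C)\<^esub> g)"
    then have g: "g \<in> Hom (Fun J C) G H" by simp
    have "zero_arrow (Fun (opposite J) (opposite C)) (op_ntrans t \<cdot>\<^bsub>Fun (opposite J) (opposite C)\<^esub> op_ntrans g)"
      using z zero[OF FC.comp_in[OF t g]] op_ntrans_comp[of J C g t] by (simp del: Fun_simps)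
    then obtain u where u: "u \<in> Hom (Fun (opposite J) (opposite C)) H (Src d)"
      "d \<cdot>\<^bsub>Fun (opposite J) (opposite C)\<^esub> u = op_ntrans g"
      using D(3)[of "op_ntrans g" H] g by auto
    have "op_ntrans u \<in> Hom (Fun J C) (Src d) H" using u(1) Hom_op_ntrans[of "op_ntrans u" J C H] by simp
    moreover have "op_ntrans u \<cdot>\<^bsub>Fun J C\<^esub> ?c = g"
      using u(2) op_ntrans_comp[of J C "op_ntrans u" ?c] by (metis op_ntrans_simps(4))
    ultimately show "\<exists>u. u \<in> Hom (opposite (Fun J C)) H (Src d) \<and> ?c \<cdot>\<^bsub>opposite (Fun J C)\<^esub> u = g"
      by (auto simp del: Fun_simps)
  qed (use t c in simp_all)
  then show thesis using that[of ?c] dX by simp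
qed

end

section \<open>Alpha preradicals\<close>

text \<open>\<open>complete_category\<close> speaks only of diagrams whose shape lives in
  \<open>'u\<close>. A small index set embeds into \<open>'u\<close>, and the product is the limit
  over the discrete category on its image. Applied to the opposite category this yields
  coproducts.\<close>

lemma (in category) product_exists:
  fixes I :: "'i set"
  assumes complete: "complete_category TYPE('u) C" and I: "small TYPE('u) I"
    and X: "\<And>i. i \<in> I \<Longrightarrow> X i \<in> Obj C"
  shows "\<exists>P p. is_product C I X P p"
proof -
  have "|I| \<le>o |UNIV :: 'u set|" using I ordLess_imp_ordLeq unfolding small_def by blast
  then obtain e :: "'i \<Rightarrow> 'u" where e: "inj_on e I" using card_of_ordLeq[of I "UNIV :: 'u set"] by auto
  define r where "r = inv_into I e"
  have re: "r (e i) = i" if "i \<in> I" for i using e that by (simp add: r_def)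
  define J :: "('u, 'u) cat" where
    "J = \<lparr>Obj = e ` I, Arr = e ` I, Dom = id, Cod = id, Idn = id, Comp = (\<lambda>g f. f)\<rparr>"
  have J_simps: "Obj J = e ` I" "Arr J = e ` I" "Dom J j = j" "Cod J j = j" "Idn J j = j"
    "Comp J g f = f" for j g f by (simp_all add: J_def)
  have catJ: "category J" by unfold_locales (auto simp: J_simps Hom_iff)
  interpret category_pair J C by (intro category_pair.intro catJ category_axioms)
  let ?D = "\<lparr>ObjMap = restrict (\<lambda>j. X (r j)) (Obj J), ArrMap = restrict (\<lambda>j. Idn C (X (r j))) (Arr J)\<rparr>"
  have "Idn C Y \<cdot> Idn C Y = Idn C Y" if "Y \<in> Obj C" for Y using idn_left_Hom[OF idn_in[OF that]] .
  then have D: "is_functor J C ?D"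
    using idn_in X by (intro functorI) (auto simp: J_simps Hom_iff re)
  have "small TYPE('u) (e ` I)"
    using I card_of_image ordLeq_ordLess_trans unfolding small_def by blast
  then have "small TYPE('u) (Obj J)" "small TYPE('u) (Arr J)" by (simp_all only: J_simps)
  then obtain P p where lim: "is_limit J C ?D P p"
    using complete catJ D unfolding complete_category_def by blast
  \<comment> \<open>All arrows of \<open>J\<close> go to identities, so the compatibility condition
    on cones is automatic and only a family of arrows remains.\<close>
  have cone_iff: "is_cone J C ?D Q q \<longleftrightarrow> Q \<in> Obj C \<and> (\<forall>i\<in>I. q (e i) \<in> Hom C Q (X i))" for Q q
    using idn_left_Hom by (auto simp: is_cone_def J_simps re)
  have "is_product C I X P (\<lambda>i. p (e i))"
    unfolding is_product_def
  proof (intro conjI ballI allI impI)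
    fix Q q assume "Q \<in> Obj C" "\<forall>i\<in>I. q i \<in> Hom C Q (X i)"
    then have "is_cone J C ?D Q (\<lambda>j. q (r j))" unfolding cone_iff by (simp add: re)
    then have "\<exists>!u. u \<in> Hom C Q P \<and> (\<forall>j\<in>Obj J. p j \<cdot> u = q (r j))"
      using lim unfolding is_limit_def by blast
    then show "\<exists>!u. u \<in> Hom C Q P \<and> (\<forall>i\<in>I. p (e i) \<cdot> u = q i)" by (simp add: J_simps re)
  qed (use lim cone_iff in \<open>auto simp: is_limit_def\<close>)
  then show ?thesis by blast
qed

text \<open>Isolates what cocompleteness and small hom-sets contribute to the alpha construction, so
  that the universe type \<open>'u\<close> no longer occurs in it.\<close>

locale category_with_copowers = category +
  assumes copower_exists: "\<lbrakk>N \<in> Obj C; M \<in> Obj C; L \<in> Obj C\<rbrakk> \<Longrightarrow>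
    \<exists>P p. is_coproduct C (Hom C M L) (\<lambda>_. N) P p"
begin

lemma alpha_coproduct:
  assumes "N \<in> Obj C" "M \<in> Obj C" "L \<in> Obj C"
  shows "is_coproduct C (Hom C M L) (\<lambda>_. N) (alpha_obj C N M L) (alpha_incl C N M L)"
proof -
  have "\<exists>Q. is_coproduct C (Hom C M L) (\<lambda>_. N) (fst Q) (snd Q)"
    using copower_exists[OF assms] by auto
  then show ?thesis unfolding alpha_obj_def alpha_incl_def copower_def by (rule someI_ex)
qed

lemma alpha_obj_in: "\<lbrakk>N \<in> Obj C; M \<in> Obj C; L \<in> Obj C\<rbrakk> \<Longrightarrow> alpha_obj C N M L \<in> Obj C"
  using alpha_coproduct unfolding is_product_def by fastforce

lemma alpha_incl_in:
  assumes "N \<in> Obj C" "f \<in> Hom C M L"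
  shows "alpha_incl C N M L f \<in> Hom C N (alpha_obj C N M L)"
  using alpha_coproduct[of N M L] assms Hom_Obj[OF assms(2)] unfolding is_product_def by simp

lemma alpha_ex1:
  assumes "N \<in> Obj C" "M \<in> Obj C" "L \<in> Obj C" "Q \<in> Obj C"
    and "\<And>f. f \<in> Hom C M L \<Longrightarrow> q f \<in> Hom C N Q"
  shows "\<exists>!u. u \<in> Hom C (alpha_obj C N M L) Q \<and>
    (\<forall>f\<in>Hom C M L. u \<cdot> alpha_incl C N M L f = q f)"
  using alpha_coproduct[OF assms(1-3)] assms(4,5) unfolding is_product_def by simp

text \<open>The canonical inclusions are jointly epic. Functoriality of
  \<open>alpha_functor\<close>, naturality of \<open>alpha_ntrans\<close> and later identities are
  all checked on one copy of \<open>N\<close> at a time.\<close>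

lemma alpha_obj_ext:
  assumes N: "N \<in> Obj C" and M: "M \<in> Obj C" and L: "L \<in> Obj C"
    and u: "u \<in> Hom C (alpha_obj C N M L) Q" and v: "v \<in> Hom C (alpha_obj C N M L) Q"
    and eq: "\<And>f. f \<in> Hom C M L \<Longrightarrow> u \<cdot> alpha_incl C N M L f = v \<cdot> alpha_incl C N M L f"
  shows "u = v"
proof -
  have "u \<cdot> alpha_incl C N M L f \<in> Hom C N Q" if "f \<in> Hom C M L" for f
    using comp_in[OF alpha_incl_in[OF N that] u] .
  from alpha_ex1[OF N M L, of Q "\<lambda>f. u \<cdot> alpha_incl C N M L f", OF _ this] u v eq Hom_Obj[OF u]
  show ?thesis by metis
qed

lemma alpha_ArrMap:
  assumes N: "N \<in> Obj C" and M: "M \<in> Obj C" and l: "l \<in> Hom C L L'"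
  shows "ArrMap (alpha_functor C N M) l \<in> Hom C (alpha_obj C N M L) (alpha_obj C N M L')"
    and "f \<in> Hom C M L \<Longrightarrow>
      ArrMap (alpha_functor C N M) l \<cdot> alpha_incl C N M L f = alpha_incl C N M L' (l \<cdot> f)"
proof -
  have L: "L \<in> Obj C" "L' \<in> Obj C" using Hom_Obj[OF l] by auto
  have q: "alpha_incl C N M L' (l \<cdot> f) \<in> Hom C N (alpha_obj C N M L')" if "f \<in> Hom C M L" for f
    using alpha_incl_in[OF N comp_in[OF that l]] .
  have "ArrMap (alpha_functor C N M) l = (THE u. u \<in> Hom C (alpha_obj C N M L) (alpha_obj C N M L') \<and>
      (\<forall>f\<in>Hom C M L. u \<cdot> alpha_incl C N M L f = alpha_incl C N M L' (l \<cdot> f)))"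
    using l by (simp add: alpha_functor_def Hom_iff)
  with theI'[OF alpha_ex1[OF N M L(1) alpha_obj_in[OF N M L(2)] q]]
  show "ArrMap (alpha_functor C N M) l \<in> Hom C (alpha_obj C N M L) (alpha_obj C N M L')"
    and "f \<in> Hom C M L \<Longrightarrow>
      ArrMap (alpha_functor C N M) l \<cdot> alpha_incl C N M L f = alpha_incl C N M L' (l \<cdot> f)"
    by simp_all
qed

lemma is_functor_alpha:
  assumes N: "N \<in> Obj C" and M: "M \<in> Obj C"
  shows "is_functor C C (alpha_functor C N M)"
proof -
  interpret CC: category_pair C C by (intro category_pair.intro category_axioms)
  \<comment> \<open>\<open>functorI\<close> expects the arrow map before restriction to
    \<open>Arr C\<close>. On arrows, \<open>A\<close> folds the description back into
    \<open>ArrMap\<close>, whose properties are known.\<close>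
  let ?A = "\<lambda>l. THE u. u \<in> Hom C (alpha_obj C N M (Dom C l)) (alpha_obj C N M (Cod C l)) \<and>
       (\<forall>f\<in>Hom C M (Dom C l).
          u \<cdot> alpha_incl C N M (Dom C l) f = alpha_incl C N M (Cod C l) (l \<cdot> f))"
  have A: "?A l = ArrMap (alpha_functor C N M) l" if "l \<in> Hom C L L'" for l L L'
    using that by (simp add: alpha_functor_def Hom_iff)
  note arr = alpha_ArrMap[OF N M] and incl = alpha_incl_in[OF N]
  show ?thesis unfolding alpha_functor_def
  proof (rule CC.functorI)
    fix L assume L: "L \<in> Obj C"
    note I = idn_in[OF L] and AL = alpha_obj_in[OF N M L]
    show "?A (Idn C L) = Idn C (alpha_obj C N M L)" unfolding A[OF I]
    proof (rule alpha_obj_ext[OF N M L arr(1)[OF I] idn_in[OF AL]])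
      fix f assume f: "f \<in> Hom C M L"
      show "ArrMap (alpha_functor C N M) (Idn C L) \<cdot> alpha_incl C N M L f =
          Idn C (alpha_obj C N M L) \<cdot> alpha_incl C N M L f"
        using arr(2)[OF I f] idn_left_Hom[OF f] idn_left_Hom[OF incl[OF f]] by simp
    qed
  next
    fix l l' L L' L'' assume l: "l \<in> Hom C L L'" and l': "l' \<in> Hom C L' L''"
    note l'l = comp_in[OF l l']
    have L: "L \<in> Obj C" using Hom_Obj[OF l] by simp
    show "?A (l' \<cdot> l) = ?A l' \<cdot> ?A l" unfolding A[OF l] A[OF l'] A[OF l'l]
    proof (rule alpha_obj_ext[OF N M L arr(1)[OF l'l] comp_in[OF arr(1)[OF l] arr(1)[OF l']]])
      fix f assume f: "f \<in> Hom C M L"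
      show "ArrMap (alpha_functor C N M) (l' \<cdot> l) \<cdot> alpha_incl C N M L f =
          (ArrMap (alpha_functor C N M) l' \<cdot> ArrMap (alpha_functor C N M) l) \<cdot> alpha_incl C N M L f"
        using comp_assoc[OF incl[OF f] arr(1)[OF l] arr(1)[OF l']] arr(2)[OF l'l f] arr(2)[OF l f]
          arr(2)[OF l' comp_in[OF f l]] comp_assoc[OF f l l'] by simp
    qed
  qed (use alpha_obj_in[OF N M] arr(1) A in auto)
qed

lemma is_functor_id: "is_functor C C (id_functor C)"
proof -
  interpret CC: category_pair C C by (intro category_pair.intro category_axioms)
  show ?thesis unfolding id_functor_def by (rule CC.functorI) auto
qed

lemma alpha_ntrans:
  assumes h: "h \<in> Hom C N M"
  shows "alpha_ntrans C h \<in> Hom (Fun C C) (alpha_functor C N M) (id_functor C)"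
    and "f \<in> Hom C M L \<Longrightarrow> Cmp (alpha_ntrans C h) L \<cdot> alpha_incl C N M L f = f \<cdot> h"
proof -
  interpret CC: category_pair C C by (intro category_pair.intro category_axioms)
  have N: "N \<in> Obj C" and M: "M \<in> Obj C" using Hom_Obj[OF h] by auto
  have DC: "Dom C h = N" "Cod C h = M" using h by (auto simp: Hom_iff)
  let ?a = "\<lambda>L. THE u. u \<in> Hom C (alpha_obj C N M L) L \<and>
       (\<forall>f\<in>Hom C M L. u \<cdot> alpha_incl C N M L f = f \<cdot> h)"
  have a: "?a L \<in> Hom C (alpha_obj C N M L) L"
    and ai: "f \<in> Hom C M L \<Longrightarrow> ?a L \<cdot> alpha_incl C N M L f = f \<cdot> h" if L: "L \<in> Obj C" for L f
    using theI'[OF alpha_ex1[OF N M L L comp_in[OF h]]] by simp_all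
  show "Cmp (alpha_ntrans C h) L \<cdot> alpha_incl C N M L f = f \<cdot> h" if f: "f \<in> Hom C M L"
    using ai[OF _ f] Hom_Obj[OF f] by (simp add: alpha_ntrans_def DC)
  note arr = alpha_ArrMap[OF N M] and incl = alpha_incl_in[OF N]
  show "alpha_ntrans C h \<in> Hom (Fun C C) (alpha_functor C N M) (id_functor C)"
    unfolding alpha_ntrans_def DC
  proof (rule CC.ntransI[OF is_functor_alpha[OF N M] is_functor_id])
    fix L assume "L \<in> Obj C"
    then show "?a L \<in> Hom C (ObjMap (alpha_functor C N M) L) (ObjMap (id_functor C) L)"
      using a by (simp add: alpha_functor_def id_functor_def)
  next
    fix l L L' assume l: "l \<in> Hom C L L'"
    then have L: "L \<in> Obj C" and L': "L' \<in> Obj C" using Hom_Obj by auto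
    have "?a L' \<cdot> ArrMap (alpha_functor C N M) l = l \<cdot> ?a L"
    \<comment> \<open>On the copy indexed by \<open>f\<close>, both sides are the composite of
      \<open>h\<close>, \<open>f\<close> and \<open>l\<close>.\<close>
    proof (rule alpha_obj_ext[OF N M L comp_in[OF arr(1)[OF l] a[OF L']] comp_in[OF a[OF L] l]])
      fix f assume f: "f \<in> Hom C M L"
      show "?a L' \<cdot> ArrMap (alpha_functor C N M) l \<cdot> alpha_incl C N M L f =
          l \<cdot> ?a L \<cdot> alpha_incl C N M L f"
        using comp_assoc[OF incl[OF f] arr(1)[OF l] a[OF L']] comp_assoc[OF incl[OF f] a[OF L] l]
          arr(2)[OF l f] ai[OF L f] ai[OF L' comp_in[OF f l]] comp_assoc[OF h f l] by simp
    qed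
    then show "?a L' \<cdot> ArrMap (alpha_functor C N M) l = ArrMap (id_functor C) l \<cdot> ?a L"
      using l by (simp add: id_functor_def Hom_iff)
  qed
qed

end

section \<open>Abelian categories\<close>

text \<open>If \<open>f\<close> identifies \<open>a\<close> and \<open>b\<close>, it kills their
  difference, which then lifts through the zero arrow \<open>k\<close> and so vanishes.\<close>

lemma preadditive_mono:
  assumes G: "preadditive C G" and f: "f \<in> Hom C X Y"
    and k: "is_kernel C f k" "zero_arrow C k"
  shows "is_mono C f"
proof -
  interpret category C using G by (simp add: preadditive_def)
  have grp: "comm_group (G A B)" and carr: "carrier (G A B) = Hom C A B"
    if "A \<in> Obj C" "B \<in> Obj C" for A B
    using G that by (simp_all add: preadditive_def)
  have distrib: "g \<cdot>\<^bsub>C\<^esub> (a \<otimes>\<^bsub>G A B\<^esub> b) = (g \<cdot>\<^bsub>C\<^esub> a) \<otimes>\<^bsub>G A D\<^esub> (g \<cdot>\<^bsub>C\<^esub> b)"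
    if "a \<in> Hom C A B" "b \<in> Hom C A B" "g \<in> Hom C B D" for g a b A B D
    using G that Hom_Obj[OF that(1)] Hom_Obj[OF that(3)] unfolding preadditive_def by blast
  obtain Z where Z: "zero_object C Z" using k(2) by (auto simp: zero_arrow_def)
  note Zobj = zero_objectD(1)[OF Z]
  \<comment> \<open>Links the categorical zero with the neutral element. An arrow into a zero object
    is unique and therefore idempotent for the group operation; bilinearity passes this on to
    \<open>z\<close>, and cancellation makes \<open>z\<close> neutral.\<close>
  have zero_one: "z = \<one>\<^bsub>G A B\<^esub>" if z: "zero_arrow C z" "z \<in> Hom C A B" for z A B
  proof -
    have A: "A \<in> Obj C" and B: "B \<in> Obj C" using Hom_Obj[OF z(2)] by auto
    obtain a b where ab: "a \<in> Hom C A Z" "b \<in> Hom C Z B" "z = b \<cdot>\<^bsub>C\<^esub> a"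
      using zero_arrow_through[OF Z z] .
    interpret AZ: comm_group "G A Z" using grp[OF A Zobj] .
    interpret AB: comm_group "G A B" using grp[OF A B] .
    have "a \<otimes>\<^bsub>G A Z\<^esub> a \<in> Hom C A Z" using AZ.m_closed ab(1) carr[OF A Zobj] by simp
    then have "a \<otimes>\<^bsub>G A Z\<^esub> a = a" using ab(1) zero_objectD(2)[OF Z A] by blast
    then have "z \<otimes>\<^bsub>G A B\<^esub> z = z" using distrib[OF ab(1,1,2)] ab(3) by simp
    then show ?thesis using AB.l_cancel_one z(2) carr[OF A B] by simp
  qed
  show ?thesis
  proof (rule monoI[OF f])
    fix W a b assume a: "a \<in> Hom C W X" and b: "b \<in> Hom C W X" and eq: "f \<cdot>\<^bsub>C\<^esub> a = f \<cdot>\<^bsub>C\<^esub> b"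
    have W: "W \<in> Obj C" and X: "X \<in> Obj C" using Hom_Obj[OF a] by auto
    interpret WX: comm_group "G W X" using grp[OF W X] .
    have carr': "carrier (G W X) = Hom C W X" using carr[OF W X] .
    \<comment> \<open>In additive notation \<open>i\<close> is -b and \<open>d\<close> is a - b.
      Comparing \<open>d\<close> with b + i, which is neutral, uses only that composition respects
      sums, without a separate rule for inverses.\<close>
    define i where "i = inv\<^bsub>G W X\<^esub> b"
    have i: "i \<in> Hom C W X" using b carr' WX.inv_closed unfolding i_def by blast
    define d where "d = a \<otimes>\<^bsub>G W X\<^esub> i"
    have d: "d \<in> Hom C W X" using a i carr' WX.m_closed unfolding d_def by blast
    have bi: "b \<otimes>\<^bsub>G W X\<^esub> i = \<one>\<^bsub>G W X\<^esub>" using b carr' unfolding i_def by simp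
    obtain z where z: "z \<in> Hom C W X" "zero_arrow C z" using zero_arrow_exists[OF Z W X] .
    have "f \<cdot>\<^bsub>C\<^esub> d = f \<cdot>\<^bsub>C\<^esub> \<one>\<^bsub>G W X\<^esub>"
      using distrib[OF a i f] distrib[OF b i f] eq bi unfolding d_def by simp
    then have "zero_arrow C (f \<cdot>\<^bsub>C\<^esub> d)"
      using zero_one[OF z(2,1)] zero_arrow_comp_left[OF z(2,1) f] by simp
    then obtain u where u: "u \<in> Hom C W (Dom C k)" "k \<cdot>\<^bsub>C\<^esub> u = d" using kernelD(3)[OF k(1) f d] by blast
    then have "d = \<one>\<^bsub>G W X\<^esub>"
      using zero_one[OF _ d] zero_arrow_comp_right[OF k(2) kernelD(1)[OF k(1) f] u(1)] by simp
    then have "a \<otimes>\<^bsub>G W X\<^esub> i = b \<otimes>\<^bsub>G W X\<^esub> i" using bi d_def by simp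
    then show "a = b" using WX.right_cancel a b i carr' by simp
  qed
qed

locale abelian = category +
  assumes abelian: "abelian_category C"
begin

lemma kernel_exists: "f \<in> Arr C \<Longrightarrow> \<exists>k. is_kernel C f k"
  and cokernel_exists: "f \<in> Arr C \<Longrightarrow> \<exists>c. is_cokernel C f c"
  and mono_is_kernel: "is_mono C m \<Longrightarrow> \<exists>f. is_kernel C f m"
  using abelian by (simp_all add: abelian_category_def)

end

section \<open>Monomorphisms and images in a functor category with abelian target\<close>

locale functors_to_abelian = category_pair J C + abelian C
  for J :: "('i, 'j) cat" and C :: "('o, 'a) cat"
begin

text \<open>A monic transformation has a zero arrow as its kernel: both \<open>k\<close> and the
  parallel zero arrow \<open>z\<close> become zero after composition with \<open>t\<close>. As that
  kernel is pointwise, each component of \<open>t\<close> has zero kernel.\<close>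

lemma mono_Fun_component:
  assumes t: "t \<in> Hom (Fun J C) F G" and mono: "is_mono (Fun J C) t" and X: "X \<in> Obj J"
  shows "is_mono C (Cmp t X)"
proof -
  obtain G' Z where G': "preadditive C G'" and Z: "zero_object C Z"
    using abelian by (auto simp: abelian_category_def)
  obtain k where k: "is_kernel (Fun J C) t k"
    and kX: "\<And>X. X \<in> Obj J \<Longrightarrow> is_kernel C (Cmp t X) (Cmp k X)"
    using kernel_Fun_exists[OF Z t kernel_exists] by blast
  note K = FC.kernelD[OF k t]
  obtain z where z: "z \<in> Hom (Fun J C) (Dom (Fun J C) k) F" "zero_arrow (Fun J C) z"
    using FC.zero_arrow_exists[OF zero_object_Fun[OF Z]] FC.Hom_Obj[OF K(1)] by blast
  have "t \<cdot>\<^bsub>Fun J C\<^esub> k = t \<cdot>\<^bsub>Fun J C\<^esub> z"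
    using FC.zero_arrow_unique[OF K(2) FC.zero_arrow_comp_left[OF z(2,1) t]]
      FC.comp_in[OF K(1) t] FC.comp_in[OF z(1) t] by blast
  then have "k = z" using FC.mono_cancel[OF mono t K(1) z(1)] by blast
  then have "zero_arrow C (Cmp k X)" using zero_arrow_Fun_iff[OF Z K(1)] z(2) X by blast
  then show ?thesis using preadditive_mono[OF G' Hom_FunD(3)[OF t X] kX[OF X]] by blast
qed

text \<open>Each component is monic, hence a kernel, hence the kernel of its cokernel. As the
  cokernel in the functor category is pointwise, these facts reassemble into \<open>t\<close> being
  the kernel of \<open>c\<close>.\<close>

lemma mono_Fun_is_kernel:
  assumes t: "t \<in> Hom (Fun J C) F G" and mono: "is_mono (Fun J C) t"
  obtains g where "is_kernel (Fun J C) g t"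
proof -
  interpret op: category "opposite (Fun J C)" using category_opposite FC.category_axioms .
  obtain Z where Z: "zero_object C Z" using abelian by (auto simp: abelian_category_def)
  obtain c where c: "is_cokernel (Fun J C) t c"
    and cX: "\<And>X. X \<in> Obj J \<Longrightarrow> is_cokernel C (Cmp t X) (Cmp c X)"
    using cokernel_Fun_exists[OF Z t cokernel_exists] by blast
  have c': "c \<in> Hom (Fun J C) G (Tgt c)" using op.kernelD(1)[OF c, of G F] t by simp
  have "is_kernel C (Cmp c X) (Cmp t X)" if "X \<in> Obj J" for X
    using C.kernel_of_cokernel cX[OF that] mono_is_kernel[OF mono_Fun_component[OF t mono that]]
    by blast
  then show thesis using that kernel_FunI[OF Z c' t] by blast
qed

lemma image_Fun_exists:
  assumes t: "t \<in> Hom (Fun J C) F G"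
  obtains c k where "is_cokernel (Fun J C) t c" "is_kernel (Fun J C) c k" "k \<in> Monos (Fun J C) G"
proof -
  interpret op: category "opposite (Fun J C)" using category_opposite FC.category_axioms .
  obtain Z where Z: "zero_object C Z" using abelian by (auto simp: abelian_category_def)
  obtain c where c: "is_cokernel (Fun J C) t c"
    using cokernel_Fun_exists[OF Z t cokernel_exists] by blast
  have c': "c \<in> Hom (Fun J C) G (Tgt c)" using op.kernelD(1)[OF c, of G F] t by simp
  obtain k where k: "is_kernel (Fun J C) c k"
    using kernel_Fun_exists[OF Z c' kernel_exists] by blast
  have "k \<in> Monos (Fun J C) G"
    using FC.kernel_mono[OF k] FC.kernelD(1)[OF k c'] by (simp add: Monos_def Hom_iff)
  then show thesis using that c k by blast
qed

end

text \<open>The equation with \<open>\<Squnion>\<close> carries information only if a least upper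
  bound exists, since the join is a choice term; hence \<open>is_lub\<close> and membership in the
  carrier are part of the conclusion.\<close>

theorem proposition7p10:
  fixes C :: "('o, 'a) cat"
    and \<tau> :: "('o, 'a, 'o, 'a) ntrans"
  assumes "grothendieck_universe TYPE('u)"
    and "abelian_category C"
    and "small_homs TYPE('u) C"
    and "bicomplete TYPE('u) C"
    and "locally_small TYPE('u) C"
    and "\<tau> \<in> Monos (Fun C C) (id_functor C)"
  shows "(\<forall>M\<in>Obj C. alpha_preradical C (Cmp \<tau> M) \<in> carrier (Pr C)) \<and>
    is_lub (Pr C) (subobject (Fun C C) \<tau>) ((\<lambda>M. alpha_preradical C (Cmp \<tau> M)) ` Obj C) \<and>
    subobject (Fun C C) \<tau> = \<Squnion>\<^bsub>Pr C\<^esub> ((\<lambda>M. alpha_preradical C (Cmp \<tau> M)) ` Obj C)"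
proof -
  have cat: "category C" using assms(2) by (auto simp: abelian_category_def preadditive_def)
  interpret category C by (rule cat)
  interpret op: category "opposite C" using category_opposite cat .
  interpret category_with_copowers C
  proof
    fix N M L assume obj: "N \<in> Obj C" "M \<in> Obj C" "L \<in> Obj C"
    have "complete_category TYPE('u) (opposite C)" "small TYPE('u) (Hom C M L)"
      using assms(3,4) obj by (simp_all add: small_homs_def bicomplete_def)
    from op.product_exists[OF this] obj
    show "\<exists>P p. is_coproduct C (Hom C M L) (\<lambda>_. N) P p" by simp
  qed
  interpret functors_to_abelian C C
    by (intro functors_to_abelian.intro category_pair.intro abelian.intro abelian_axioms.intro cat assms(2))
  let ?F = "Fun C C" and ?I = "id_functor C" and ?\<alpha> = "\<lambda>M. alpha_preradical C (Cmp \<tau> M)"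
  let ?T = "Src \<tau>"
  note \<tau>M = assms(6)
  have mono_\<tau>: "is_mono ?F \<tau>" and \<tau>: "\<tau> \<in> Hom ?F ?T ?I"
    using \<tau>M by (auto simp: Monos_def is_mono_def Hom_Fun)
  have id_obj: "ObjMap ?I L = L" if "L \<in> Obj C" for L using that by (simp add: id_functor_def)
  have id_arr: "ArrMap ?I f = f" if "f \<in> Hom C L L'" for f L L'
    using that by (simp add: id_functor_def Hom_iff)
  have \<tau>X: "Cmp \<tau> M \<in> Hom C (ObjMap ?T M) M" if "M \<in> Obj C" for M
    using Hom_FunD(3)[OF \<tau> that] id_obj[OF that] by simp
  have factor: "\<exists>w. w \<in> Hom ?F (alpha_functor C (ObjMap ?T M) M) ?T \<and>
      \<tau> \<cdot>\<^bsub>?F\<^esub> w = alpha_ntrans C (Cmp \<tau> M)" if M: "M \<in> Obj C" for M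
  proof (rule ntrans_lift[OF \<tau> mono_Fun_component[OF \<tau> mono_\<tau>] alpha_ntrans(1)[OF \<tau>X[OF M]]])
    fix L assume L: "L \<in> Obj C"
    have T: "is_functor C C ?T" using Hom_FunD(1)[OF \<tau>] .
    let ?N = "ObjMap ?T M"
    note N = functorD(1)[OF T M] and TL = functorD(1)[OF T L]
    \<comment> \<open>On the copy indexed by \<open>f\<close>, the lift is
      \<open>ArrMap ?T f\<close>. Only this one object \<open>L\<close> is treated; naturality in
      \<open>L\<close> comes from \<open>ntrans_lift\<close>.\<close>
    obtain w where w: "w \<in> Hom C (alpha_obj C ?N M L) (ObjMap ?T L)"
      "\<And>f. f \<in> Hom C M L \<Longrightarrow> w \<cdot>\<^bsub>C\<^esub> alpha_incl C ?N M L f = ArrMap ?T f"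
      using alpha_ex1[OF N M L TL functorD(2)[OF T], of "\<lambda>f. f"] by blast
    have \<alpha>: "Cmp (alpha_ntrans C (Cmp \<tau> M)) L \<in> Hom C (alpha_obj C ?N M L) L"
      using Hom_FunD(3)[OF alpha_ntrans(1)[OF \<tau>X[OF M]] L] L by (simp add: alpha_functor_def id_obj)
    have "Cmp \<tau> L \<cdot>\<^bsub>C\<^esub> w = Cmp (alpha_ntrans C (Cmp \<tau> M)) L"
    proof (rule alpha_obj_ext[OF N M L comp_in[OF w(1) \<tau>X[OF L]] \<alpha>])
      fix f assume f: "f \<in> Hom C M L"
      show "(Cmp \<tau> L \<cdot>\<^bsub>C\<^esub> w) \<cdot>\<^bsub>C\<^esub> alpha_incl C ?N M L f =
          Cmp (alpha_ntrans C (Cmp \<tau> M)) L \<cdot>\<^bsub>C\<^esub> alpha_incl C ?N M L f"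
        using comp_assoc[OF alpha_incl_in[OF N f] w(1) \<tau>X[OF L]] w(2)[OF f]
          alpha_ntrans(2)[OF \<tau>X[OF M] f] Hom_FunD(4)[OF \<tau> f] id_arr[OF f] by simp
    qed
    then show "\<exists>w\<in>Hom C (ObjMap (alpha_functor C ?N M) L) (ObjMap ?T L).
        Cmp \<tau> L \<cdot>\<^bsub>C\<^esub> w = Cmp (alpha_ntrans C (Cmp \<tau> M)) L"
      using w(1) L by (auto simp: alpha_functor_def)
  qed
  \<comment> \<open>A representative \<open>k\<close> of the image together with two comparisons:
    \<open>k\<close> below \<tau> makes \<tau> an upper bound, and the factorization of
    \<open>alpha_ntrans\<close> through \<open>k\<close> serves leastness.\<close>
  have image: "\<exists>k. ?\<alpha> M = subobject ?F k \<and> k \<in> Monos ?F ?I \<and> factors_through ?F k \<tau> \<and>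
      factors_through ?F (alpha_ntrans C (Cmp \<tau> M)) k" if M: "M \<in> Obj C" for M
  proof -
    let ?a = "alpha_ntrans C (Cmp \<tau> M)"
    note a = alpha_ntrans(1)[OF \<tau>X[OF M]]
    obtain c k where ck: "is_cokernel ?F ?a c" "is_kernel ?F c k" and k: "k \<in> Monos ?F ?I"
      using image_Fun_exists[OF a] .
    obtain g where g: "is_kernel ?F g \<tau>" using mono_Fun_is_kernel[OF \<tau> mono_\<tau>] .
    have "Dom ?F ?a = alpha_functor C (ObjMap ?T M) M" "Dom ?F \<tau> = ?T" using a by (simp_all add: Hom_Fun)
    then have "factors_through ?F ?a \<tau>" using factor[OF M] unfolding factors_through_def by metis
    from FC.image_factors_through_kernel[OF ck g this] FC.image_subobject_eq[OF ck]
      FC.factors_through_image[OF ck] k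
    show ?thesis unfolding alpha_preradical_def by blast
  qed
  have carr: "?\<alpha> M \<in> carrier (Pr C)" if "M \<in> Obj C" for M
    using image[OF that] unfolding Pr_def carrier_Sub by blast
  have lub: "is_lub (Pr C) (subobject ?F \<tau>) (?\<alpha> ` Obj C)"
    unfolding least_def
  proof (intro conjI ballI)
    show "Upper (Pr C) (?\<alpha> ` Obj C) \<subseteq> carrier (Pr C)" by (rule Upper_closed)
    have "?\<alpha> M \<sqsubseteq>\<^bsub>Pr C\<^esub> subobject ?F \<tau>" if "M \<in> Obj C" for M
      using image[OF that] FC.subobject_le_iff[OF _ \<tau>M] unfolding Pr_def by auto
    then show "subobject ?F \<tau> \<in> Upper (Pr C) (?\<alpha> ` Obj C)"
      using \<tau>M by (auto simp: Upper_def Pr_def carrier_Sub)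
  next
    fix s assume s: "s \<in> Upper (Pr C) (?\<alpha> ` Obj C)"
    then obtain \<sigma> where \<sigma>M: "\<sigma> \<in> Monos ?F ?I" and s_eq: "s = subobject ?F \<sigma>"
      unfolding Upper_def Pr_def carrier_Sub by blast
    have mono_\<sigma>: "is_mono ?F \<sigma>" and \<sigma>: "\<sigma> \<in> Hom ?F (Src \<sigma>) ?I"
      using \<sigma>M by (auto simp: Monos_def is_mono_def Hom_Fun)
    \<comment> \<open>For each \<open>M\<close> the lift is cut out of a different transformation
      \<open>v\<close>, with nothing relating them as \<open>M\<close> varies; monicity of the
      components of \<sigma> is what makes the lifts fit together.\<close>
    have "\<exists>w. w \<in> Hom ?F ?T (Src \<sigma>) \<and> \<sigma> \<cdot>\<^bsub>?F\<^esub> w = \<tau>"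
    proof (rule ntrans_lift[OF \<sigma> mono_Fun_component[OF \<sigma> mono_\<sigma>] \<tau>])
      fix M assume M: "M \<in> Obj C"
      let ?a = "alpha_ntrans C (Cmp \<tau> M)" and ?N = "ObjMap ?T M"
      note a = alpha_ntrans[OF \<tau>X[OF M]]
      have N: "?N \<in> Obj C" using Hom_Obj[OF \<tau>X[OF M]] by simp
      obtain k where k: "?\<alpha> M = subobject ?F k" "k \<in> Monos ?F ?I" "factors_through ?F ?a k"
        using image[OF M] by blast
      have "?\<alpha> M \<sqsubseteq>\<^bsub>Pr C\<^esub> s" using s carr[OF M] M unfolding Upper_def by blast
      then have "factors_through ?F k \<sigma>"
        using FC.subobject_le_iff[OF k(2) \<sigma>M] unfolding k(1) s_eq Pr_def by simp
      then have "factors_through ?F ?a \<sigma>" using FC.factors_through_trans k(3) \<sigma> by (simp add: Hom_Fun)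
      then obtain v where v: "v \<in> Hom ?F (alpha_functor C ?N M) (Src \<sigma>)" "?a = \<sigma> \<cdot>\<^bsub>?F\<^esub> v"
        using a(1) by (auto simp: factors_through_def Hom_Fun simp del: Fun_simps(6))
      \<comment> \<open>The witness is \<open>Cmp v M\<close> restricted along the inclusion indexed
        by \<open>Idn C M\<close>, so \<open>v\<close> is evaluated only at the object
        \<open>M\<close> itself.\<close>
      note id = idn_in[OF M]
      note i = alpha_incl_in[OF N id]
      have vM: "Cmp v M \<in> Hom C (alpha_obj C ?N M M) (ObjMap (Src \<sigma>) M)"
        using Hom_FunD(3)[OF v(1) M] M by (simp add: alpha_functor_def)
      have "Cmp \<sigma> M \<cdot>\<^bsub>C\<^esub> (Cmp v M \<cdot>\<^bsub>C\<^esub> alpha_incl C ?N M M (Idn C M)) =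
          Cmp ?a M \<cdot>\<^bsub>C\<^esub> alpha_incl C ?N M M (Idn C M)"
        using comp_assoc[OF i vM, of "Cmp \<sigma> M" M] Hom_FunD(3)[OF \<sigma> M] id_obj[OF M] v(2) M by simp
      also have "\<dots> = Cmp \<tau> M" using a(2)[OF id] idn_left_Hom[OF \<tau>X[OF M]] by simp
      finally show "\<exists>w\<in>Hom C ?N (ObjMap (Src \<sigma>) M). Cmp \<sigma> M \<cdot>\<^bsub>C\<^esub> w = Cmp \<tau> M"
        using comp_in[OF i vM] by blast
    qed
    then have "factors_through ?F \<tau> \<sigma>"
      unfolding factors_through_def by (auto simp del: Fun_simps(6))
    then show "subobject ?F \<tau> \<sqsubseteq>\<^bsub>Pr C\<^esub> s"
      using FC.subobject_le_iff[OF \<tau>M \<sigma>M] unfolding s_eq Pr_def by simp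
  qed
  show ?thesis using carr lub FC.Sub_lub_eq_join unfolding Pr_def by blast
qed

end
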